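(* Let $G$ be a finite, simple, connected, undirected graph. Then the halved doubled Lovász complex $\mathsf{HDL}(G)$ is a strong $\mathbb{Z}_2$-deformation retract of the box complex $\mathsf{B}(G)$. That is, regarding $\|\mathsf{HDL}(G)\|$ as a subspace of $\|\mathsf{B}(G)\|=\|\mathrm{ssd}(\mathsf{B}(G))\|$, where $\mathrm{ssd}(\mathsf{B}(G))$ is the shore subdivision of $\mathsf{B}(G)$, the space $\|\mathsf{HDL}(G)\|$ is a strong $\mathbb{Z}_2$-deformation retract of $\|\mathsf{B}(G)\|$.
   Context: $V(G)$ is the node set of $G$. For $A\subseteq V(G)$, $\mathrm{CN}(A)$ is the set of all nodes adjacent to every $a\in A$, with $\mathrm{CN}(\emptyset)=V(G)$; $\mathrm{CN}^2(A)=\mathrm{CN}(\mathrm{CN}(A))$. The neighborhood complex $\mathsf{N}(G)$ is the abstract simplicial complex whose simplices are the sets $A\subseteq V(G)$ with $\mathrm{CN}(A)\ne\emptyset$. A chain $\mathcal{A}$ is a (possibly empty) family $A_1\subset\dots\subset A_p$ of strictly increasing subsets of $V(G)$. For sets $A,B$ put $A\uplus B:=\{(a,0):a\in A\}\cup\{(b,1):b\in B\}$. $\|K\|$ denotes the geometric realization of a simplicial complex $K$. Lovász complex: $\mathsf{L}(G)$ is the subcomplex of the barycentric subdivision $\mathrm{sd}(\mathsf{N}(G))$ induced by the fixed points of $\mathrm{CN}^2$. That is, its vertices are the nonempty sets $A\subseteq V(G)$ with $\mathrm{CN}(A)\ne\emptyset$ and $\mathrm{CN}^2(A)=A$, and its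 simplices are the chains of such sets. Box complex: $\mathsf{B}(G):=\{A\uplus B: A,B\in\mathsf{N}(G),\ A\subseteq\mathrm{CN}(B),\ B\subseteq\mathrm{CN}(A)\}$, with the free simplicial $\mathbb{Z}_2$-action $A\uplus B\mapsto B\uplus A$. Its two shores are the subcomplexes induced by the vertices $(v,0)$ and by the vertices $(v,1)$, respectively. Shore subdivision: $\mathrm{ssd}(\mathsf{B}(G))$ is the simplicial complex consisting of the simplices of the joins $\mathrm{sd}(\sigma\cap K_1)*\mathrm{sd}(\sigma\cap K_2)$, $\sigma\in\mathsf{B}(G)$, where $K_1,K_2$ are the two shores. Explicitly: its vertices are denoted $A\uplus\emptyset$ (first shore) and $\emptyset\uplus A$ (second shore), for $\emptyset\neq A\subseteq V(G)$ with $\mathrm{CN}(A)\neq\emptyset$. Its simplices are denoted $\mathcal{A}\uplus\mathcal{B}$, spanned by the vertices $A\uplus\emptyset$ ($A\in\mathcal{A}$) and $\emptyset\uplus B$ ($B\in\mathcal{B}$), where $\mathcal{A},\mathcal{B}$ are chains of such sets with $A\subseteq\mathrm{CN}(B)$ for all $A\in\mathcal{A}$, $B\in\mathcal{B}$. Its $\mathbb{Z}_2$-action interchanges $A\uplus\emptyset$ and $\emptyset\uplus A$. It is a subdivision of $\mathsf{B}(G)$: $\|\mathrm{ssd}(\mathsf{B}(G))\|$ is identified $\mathbb{Z}_2$-equivariantly with $\|\mathsf{B}(G)\|$ by placing each vertex $A\uplus\emptyset$ (resp. $\emptyset\uplus A$) at the barycenter of the simplex $A\uplus\emptyset$ (resp.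 $\emptyset\uplus A$) of $\mathsf{B}(G)$ and extending affinely on simplices. Doubled Lovász complex: $\mathsf{DL}(G)$ is the image of the simplicial $\mathbb{Z}_2$-map $\mathrm{ssd}(\mathsf{B}(G))\to\mathrm{ssd}(\mathsf{B}(G))$ given on vertices by $A\uplus\emptyset\mapsto\mathrm{CN}^2(A)\uplus\emptyset$ and $\emptyset\uplus A\mapsto\emptyset\uplus\mathrm{CN}^2(A)$. Explicitly, $\mathsf{DL}(G)$ consists of all $\mathcal{A}\uplus\mathcal{B}$ with $\mathcal{A},\mathcal{B}\in\mathsf{L}(G)$ (possibly empty) such that every $a\in A$ is adjacent to every $b\in B$ for all $A\in\mathcal{A}$, $B\in\mathcal{B}$. Halved doubled Lovász complex: fix a linear order on $V(G)$ and define a linear order $\prec$ on the vertices of $\mathsf{L}(G)$ by $A\prec B$ iff $|A|<|B|$, or $|A|=|B|$ and $A<_{\mathrm{lex}}B$ (lexicographic order). The vertices of $\mathsf{DL}(G)$ are partitioned into pairs $\{A\uplus\emptyset,\ \emptyset\uplus\mathrm{CN}(A)\}$, and each pair is ordered by: $A\uplus\emptyset\prec\emptyset\uplus\mathrm{CN}(A)$ iff $A\prec\mathrm{CN}(A)$ (otherwise $\emptyset\uplus\mathrm{CN}(A)$ is the smaller one). Define the simplicial $\mathbb{Z}_2$-map $j:\mathsf{DL}(G)\to\mathsf{DL}(G)$ on vertices by $j(A\uplus\emptyset)=\min_\prec\{A\uplus\emptyset,\emptyset\uplus\mathrm{CN}(A)\}$ and $j(\emptyset\uplus B)=\min_\prec\{\emptyset\uplus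 B,\mathrm{CN}(B)\uplus\emptyset\}$. Then $\mathsf{HDL}(G):=\operatorname{im} j=\{j(\sigma):\sigma\in\mathsf{DL}(G)\}$, a $\mathbb{Z}_2$-invariant subcomplex of $\mathrm{ssd}(\mathsf{B}(G))$. Strong $\mathbb{Z}_2$-deformation retract: for a $\mathbb{Z}_2$-space $(X,\nu)$ (a space with a free self-inverse homeomorphism $\nu$), a $\nu$-invariant subspace $Y\subseteq X$ is a strong $\mathbb{Z}_2$-deformation retract of $X$ if there is a continuous map $F:X\times[0,1]\to X$ with $F(x,0)=x$ and $F(x,1)\in Y$ for all $x\in X$, $F(y,t)=y$ for all $y\in Y$, $t\in[0,1]$, and $F(\nu(x),t)=\nu(F(x,t))$ for all $x\in X$, $t\in[0,1]$. *)

theory Defs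
  imports "HOL-Analysis.Analysis" "Graph_Theory.Digraph_Component"
begin

section \<open>Geometric realization of finite abstract simplicial complexes\<close>

text \<open>
  A point of the realization is given by its barycentric coordinates.  The topology is the one
  inherited from the product topology on functions; for complexes with finitely many vertices
  (the only ones occurring below) this is the usual topology of the realization.
  Whether the empty simplex belongs to \<open>K\<close> makes no difference.
\<close>

definition realization :: "'v set set \<Rightarrow> ('v \<Rightarrow> real) set" where
  "realization K =
     {x. (\<forall>v. 0 \<le> x v) \<and> {v. x v \<noteq> 0} \<in> K \<and> (\<Sum>v | x v \<noteq> 0. x v) = 1}"

definition barycenter :: "'v set \<Rightarrow> 'v \<Rightarrow> real" where
  "barycenter \<sigma> = (\<lambda>v. indicator \<sigma> v / real (card \<sigma>))"

text \<open>Placing each vertex \<open>v\<close> at \<open>p v\<close> and extending affinely on simplices.\<close>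

definition affine_extension :: "('v \<Rightarrow> 'w \<Rightarrow> real) \<Rightarrow> ('v \<Rightarrow> real) \<Rightarrow> 'w \<Rightarrow> real" where
  "affine_extension p x = (\<lambda>w. \<Sum>v | x v \<noteq> 0. x v * p v w)"

definition realization_map :: "('v \<Rightarrow> 'w) \<Rightarrow> ('v \<Rightarrow> real) \<Rightarrow> 'w \<Rightarrow> real" where
  "realization_map f = affine_extension (\<lambda>v. barycenter {f v})"

definition simplicial_image :: "('v \<Rightarrow> 'w) \<Rightarrow> 'v set set \<Rightarrow> 'w set set" where
  "simplicial_image f K = {f ` \<sigma> | \<sigma>. \<sigma> \<in> K}"

definition barycentric_subdivision :: "'v set set \<Rightarrow> 'v set set set" where
  "barycentric_subdivision K = {\<A>. finite \<A> \<and> \<A> \<subseteq> K - {{}} \<and> chain\<^sub>\<subseteq> \<A>}"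

definition induced_subcomplex :: "'v set set \<Rightarrow> 'v set \<Rightarrow> 'v set set" where
  "induced_subcomplex K W = {\<sigma> \<in> K. \<sigma> \<subseteq> W}"


section \<open>Strong $\mathbb{Z}_2$-deformation retracts\<close>

definition Z2_space :: "'b::topological_space set \<Rightarrow> ('b \<Rightarrow> 'b) \<Rightarrow> bool" where
  "Z2_space X \<nu> \<longleftrightarrow> homeomorphism X X \<nu> \<nu> \<and> (\<forall>x\<in>X. \<nu> x \<noteq> x)"

definition strong_Z2_deformation_retract ::
    "'b::topological_space set \<Rightarrow> ('b \<Rightarrow> 'b) \<Rightarrow> 'b set \<Rightarrow> bool" where
  "strong_Z2_deformation_retract X \<nu> Y \<longleftrightarrow>
     Z2_space X \<nu> \<and> Y \<subseteq> X \<and> \<nu> ` Y \<subseteq> Y \<and>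
     (\<exists>F :: 'b \<times> real \<Rightarrow> 'b.
        continuous_on (X \<times> {0..1}) F \<and> F ` (X \<times> {0..1}) \<subseteq> X \<and>
        (\<forall>x\<in>X. F (x, 0) = x \<and> F (x, 1) \<in> Y) \<and>
        (\<forall>y\<in>Y. \<forall>t\<in>{0..1}. F (y, t) = y) \<and>
        (\<forall>x\<in>X. \<forall>t\<in>{0..1}. F (\<nu> x, t) = \<nu> (F (x, t))))"


section \<open>Complexes associated with a graph\<close>

definition CN :: "'a pair_pre_digraph \<Rightarrow> 'a set \<Rightarrow> 'a set" where
  "CN G A = {v \<in> pverts G. \<forall>a\<in>A. (a, v) \<in> parcs G}"

definition neighborhood_complex :: "'a pair_pre_digraph \<Rightarrow> 'a set set" where
  "neighborhood_complex G = {A. A \<subseteq> pverts G \<and> CN G A \<noteq> {}}"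

definition lovasz_complex :: "'a pair_pre_digraph \<Rightarrow> 'a set set set" where
  "lovasz_complex G =
     induced_subcomplex (barycentric_subdivision (neighborhood_complex G)) {A. CN G (CN G A) = A}"

text \<open>The disjoint union of \<open>A\<close> and \<open>B\<close> is \<open>A <+> B\<close>: \<open>Inl\<close> tags the first shore, \<open>Inr\<close> the second.\<close>

definition box_complex :: "'a pair_pre_digraph \<Rightarrow> ('a + 'a) set set" where
  "box_complex G = {A <+> B | A B.
     A \<in> neighborhood_complex G \<and> B \<in> neighborhood_complex G \<and> A \<subseteq> CN G B \<and> B \<subseteq> CN G A}"

definition swap_shores :: "'b + 'b \<Rightarrow> 'b + 'b" where
  "swap_shores = case_sum Inr Inl"

text \<open>
  In the shore subdivision, \<open>Inl A\<close> and \<open>Inr A\<close> encode the vertices given by the simplices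
  \<open>A <+> {}\<close> and \<open>{} <+> A\<close> of the box complex; \<open>\<A> <+> \<B>\<close> is the simplex spanned by two chains.
\<close>

definition shore_subdivision :: "'a pair_pre_digraph \<Rightarrow> ('a set + 'a set) set set" where
  "shore_subdivision G = {\<A> <+> \<B> | \<A> \<B>.
     \<A> \<in> barycentric_subdivision (neighborhood_complex G) \<and>
     \<B> \<in> barycentric_subdivision (neighborhood_complex G) \<and>
     (\<forall>A\<in>\<A>. \<forall>B\<in>\<B>. A \<subseteq> CN G B)}"

definition shore_simplex :: "'a set + 'a set \<Rightarrow> ('a + 'a) set" where
  "shore_simplex = case_sum (\<lambda>A. A <+> {}) (\<lambda>B. {} <+> B)"

text \<open>The identification of the realization of the shore subdivision with that of the box complex.\<close>

definition shore_placement :: "('a set + 'a set \<Rightarrow> real) \<Rightarrow> 'a + 'a \<Rightarrow> real" where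
  "shore_placement = affine_extension (\<lambda>s. barycenter (shore_simplex s))"

definition doubled_lovasz_complex :: "'a pair_pre_digraph \<Rightarrow> ('a set + 'a set) set set" where
  "doubled_lovasz_complex G =
     simplicial_image (map_sum (\<lambda>A. CN G (CN G A)) (\<lambda>A. CN G (CN G A))) (shore_subdivision G)"


subsection \<open>Halving\<close>

text \<open>Lexicographic comparison of the increasing enumerations with respect to the order \<open>r\<close>.\<close>

definition set_lex_less :: "'a rel \<Rightarrow> 'a set \<Rightarrow> 'a set \<Rightarrow> bool" where
  "set_lex_less r A B \<longleftrightarrow>
     (\<exists>xs ys. set xs = A \<and> sorted_wrt (\<lambda>x y. (x, y) \<in> r - Id) xs \<and>
              set ys = B \<and> sorted_wrt (\<lambda>x y. (x, y) \<in> r - Id) ys \<and>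
              (xs, ys) \<in> lexord (r - Id))"

definition set_prec :: "'a rel \<Rightarrow> 'a set \<Rightarrow> 'a set \<Rightarrow> bool" where
  "set_prec r A B \<longleftrightarrow> card A < card B \<or> card A = card B \<and> set_lex_less r A B"

text \<open>
  On a vertex, \<open>halving_map\<close> picks the smaller member of its pair \<open>{Inl A, Inr (CN G A)}\<close>;
  \<open>Inr B\<close> lies in the pair \<open>{Inl (CN G B), Inr B}\<close>, as \<open>B\<close> is a fixed point of the double common
  neighborhood.  In a loopless graph the two sets to be compared are distinct.
\<close>

definition halving_map :: "'a pair_pre_digraph \<Rightarrow> 'a rel \<Rightarrow> 'a set + 'a set \<Rightarrow> 'a set + 'a set" where
  "halving_map G r = case_sum
     (\<lambda>A. if set_prec r A (CN G A) then Inl A else Inr (CN G A))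
     (\<lambda>B. if set_prec r (CN G B) B then Inl (CN G B) else Inr B)"

definition halved_doubled_lovasz_complex ::
    "'a pair_pre_digraph \<Rightarrow> 'a rel \<Rightarrow> ('a set + 'a set) set set" where
  "halved_doubled_lovasz_complex G r =
     simplicial_image (halving_map G r) (doubled_lovasz_complex G)"


subsection \<open>Explicit description of the doubled Lovasz complex\<close>

lemma (in pair_graph) CN_antimono: "A \<subseteq> B \<Longrightarrow> CN G B \<subseteq> CN G A"
  by (auto simp: CN_def)

lemma (in pair_graph) arc_sym: "(a, b) \<in> parcs G \<Longrightarrow> (b, a) \<in> parcs G"
  using pair_sym_arcs by (auto simp: symmetric_def elim: symE)

lemma (in pair_graph) subset_CN2: "A \<subseteq> pverts G \<Longrightarrow> A \<subseteq> CN G (CN G A)"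
  by (auto simp: CN_def intro: arc_sym)

lemma (in pair_graph) CN3: "A \<subseteq> pverts G \<Longrightarrow> CN G (CN G (CN G A)) = CN G A"
proof (rule antisym)
  assume A: "A \<subseteq> pverts G"
  show "CN G (CN G (CN G A)) \<subseteq> CN G A" using CN_antimono[OF subset_CN2[OF A]] .
  have "CN G A \<subseteq> pverts G" by (auto simp: CN_def)
  then show "CN G A \<subseteq> CN G (CN G (CN G A))" by (rule subset_CN2)
qed

lemma (in pair_graph) doubled_lovasz_complex_explicit:
  "doubled_lovasz_complex G = {\<A> <+> \<B> | \<A> \<B>.
     \<A> \<in> lovasz_complex G \<and> \<B> \<in> lovasz_complex G \<and>
     (\<forall>A\<in>\<A>. \<forall>B\<in>\<B>. \<forall>a\<in>A. \<forall>b\<in>B. (a, b) \<in> parcs G)}"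
    (is "?L = ?R")
proof -
  let ?c = "\<lambda>A. CN G (CN G A)"
  let ?S = "barycentric_subdivision (neighborhood_complex G)"
  have map_plus: "map_sum ?c ?c ` (\<A> <+> \<B>) = ?c ` \<A> <+> ?c ` \<B>" for \<A> \<B>
    by (auto simp: Plus_def image_Un image_image)
  have sub: "A \<subseteq> pverts G" if "\<A> \<in> ?S" "A \<in> \<A>" for \<A> A
    using that by (auto simp: barycentric_subdivision_def neighborhood_complex_def)
  have lov: "?c ` \<A> \<in> lovasz_complex G" if S: "\<A> \<in> ?S" for \<A>
  proof -
    have "?c A \<noteq> {} \<and> ?c A \<subseteq> pverts G \<and> CN G (?c A) \<noteq> {}" if "A \<in> \<A>" for A
    proof -
      have "A \<noteq> {}" "CN G A \<noteq> {}"
        using that S by (auto simp: barycentric_subdivision_def neighborhood_complex_def)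
      moreover have "?c A \<subseteq> pverts G" unfolding CN_def[of G "CN G A"] by blast
      ultimately show ?thesis
        using subset_CN2[OF sub[OF S that]] CN3[OF sub[OF S that]] by auto
    qed
    moreover have "chain\<^sub>\<subseteq> (?c ` \<A>)"
      unfolding chain_subset_def
    proof (intro ballI)
      fix X Y assume "X \<in> ?c ` \<A>" "Y \<in> ?c ` \<A>"
      then obtain A B where AB: "A \<in> \<A>" "B \<in> \<A>" "X = ?c A" "Y = ?c B" by blast
      then have "A \<subseteq> B \<or> B \<subseteq> A"
        using S by (simp add: barycentric_subdivision_def chain_subset_def)
      then show "X \<subseteq> Y \<or> Y \<subseteq> X"
        unfolding AB using CN_antimono[OF CN_antimono] by metis
    qed
    moreover have "?c (?c A) = ?c A" if "A \<in> \<A>" for A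
      using CN3[OF sub[OF S that]] by simp
    ultimately show ?thesis using S
      by (auto simp: lovasz_complex_def induced_subcomplex_def barycentric_subdivision_def
          neighborhood_complex_def)
  qed
  show ?thesis
  proof (intro antisym subsetI)
    fix \<sigma> assume "\<sigma> \<in> ?L"
    then obtain \<A> \<B> where AB: "\<A> \<in> ?S" "\<B> \<in> ?S" "\<forall>A\<in>\<A>. \<forall>B\<in>\<B>. A \<subseteq> CN G B"
      and \<sigma>: "\<sigma> = ?c ` \<A> <+> ?c ` \<B>"
      by (auto simp: doubled_lovasz_complex_def simplicial_image_def shore_subdivision_def map_plus)
    have "(a, b) \<in> parcs G" if "A \<in> \<A>" "B \<in> \<B>" "a \<in> ?c A" "b \<in> ?c B" for A B a b
    proof -
      have "?c A \<subseteq> CN G (?c B)"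
        using CN_antimono[OF CN_antimono[of A "CN G B"]] AB that CN3[OF sub[OF AB(2) that(2)]]
        by auto
      then have "(b, a) \<in> parcs G" using that by (auto simp: CN_def)
      then show ?thesis by (rule arc_sym)
    qed
    then have "\<forall>A\<in>?c ` \<A>. \<forall>B\<in>?c ` \<B>. \<forall>a\<in>A. \<forall>b\<in>B. (a, b) \<in> parcs G"
      by simp
    then show "\<sigma> \<in> ?R"
      unfolding \<sigma> mem_Collect_eq using lov[OF AB(1)] lov[OF AB(2)]
      by (intro exI[of _ "?c ` \<A>"] exI[of _ "?c ` \<B>"]) simp
  next
    fix \<sigma> assume "\<sigma> \<in> ?R"
    then obtain \<A> \<B> where AB: "\<A> \<in> lovasz_complex G" "\<B> \<in> lovasz_complex G"
      and adj: "\<forall>A\<in>\<A>. \<forall>B\<in>\<B>. \<forall>a\<in>A. \<forall>b\<in>B. (a, b) \<in> parcs G"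
      and \<sigma>: "\<sigma> = \<A> <+> \<B>" by blast
    have S: "\<A> \<in> ?S" "\<B> \<in> ?S" and "\<forall>A\<in>\<A>. ?c A = A" "\<forall>B\<in>\<B>. ?c B = B"
      using AB by (auto simp: lovasz_complex_def induced_subcomplex_def)
    then have "?c ` \<A> = \<A>" "?c ` \<B> = \<B>" by (simp_all add: image_def)
    then have "\<sigma> = map_sum ?c ?c ` (\<A> <+> \<B>)" unfolding \<sigma> map_plus by simp
    moreover have "\<A> <+> \<B> \<in> shore_subdivision G"
    proof -
      have "a \<in> CN G B" if "A \<in> \<A>" "B \<in> \<B>" "a \<in> A" for A B a
      proof -
        have "a \<in> pverts G" using sub[OF S(1) that(1)] that(3) by (rule subsetD)
        moreover have "(b, a) \<in> parcs G" if "b \<in> B" for b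
          using adj \<open>A \<in> \<A>\<close> \<open>B \<in> \<B>\<close> \<open>a \<in> A\<close> that by (blast intro: arc_sym[of a b])
        ultimately show ?thesis by (simp add: CN_def)
      qed
      then have "\<forall>A\<in>\<A>. \<forall>B\<in>\<B>. A \<subseteq> CN G B" by blast
      then show ?thesis using S by (auto simp: shore_subdivision_def)
    qed
    ultimately show "\<sigma> \<in> ?L"
      unfolding doubled_lovasz_complex_def simplicial_image_def mem_Collect_eq
      by (intro exI[of _ "\<A> <+> \<B>"] conjI)
  qed
qed

end

theory Submission
  imports Defs
begin

text \<open>
  Every homotopy is a straight line in the realization of the box complex, so only carriers have
  to be controlled.  First, \<open>CN\<^sup>2\<close> retracts the shore subdivision to the doubled Lovasz complex: a
  simplex of the subdivision and its image lie in a common simplex of the box complex.  The halving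
  map itself is not carried in this way, but it becomes so when it is applied in order of decreasing
  cardinality: when the sets of size \<open>n\<close> are moved, a moved set \<open>A\<close> is the largest on its shore, so
  that every \<open>A'\<close> on its shore satisfies \<open>A' \<subseteq> A = CN (CN A)\<close> and adding \<open>CN A\<close> on the
  opposite shore yields a simplex again.  The passage from the realization of the box complex to
  coordinates of the shore subdivision is the explicit layer-cake formula, hence continuous.
\<close>

section \<open>Layer-cake coordinates\<close>

text \<open>Why a single halving step fails: let \<open>A \<subset> A'\<close> be closed sets on one
  shore such that \<open>CN A\<close> precedes \<open>A\<close>. Then \<open>CN A'\<close> precedes
  \<open>A'\<close> as well, so both sets change shore. A straight line from this simplex to its
  image would need a box simplex with \<open>A'\<close> on one shore and \<open>CN A\<close> on the
  other, that is \<open>A' \<subseteq> CN (CN A) = A\<close>. Once \<open>A'\<close> has been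
  replaced by \<open>CN A'\<close>, moving \<open>A\<close> is harmless, since
  \<open>CN A' \<subseteq> CN A\<close>. The other obstacle is continuity. The maps are affine only
  on the simplices of the subdivision, and a definition simplex by simplex would have to be glued.
  Recovering the coordinates of the subdivision by one formula in maxima and minima makes each stage
  a fixed finite sum of continuous functions. A stage that deforms a smaller complex may run outside
  it, within the box complex. Stages are therefore joined by precomposing with the retraction
  reached so far.\<close>

lemma continuous_on_Max_image:
  fixes f :: "'i \<Rightarrow> 'b::topological_space \<Rightarrow> real"
  assumes "finite A" "A \<noteq> {}" "\<And>i. i \<in> A \<Longrightarrow> continuous_on S (f i)"
  shows "continuous_on S (\<lambda>y. Max ((\<lambda>i. f i y) ` A))"
  using assms
proof (induction A rule: finite_ne_induct)
  case (insert x F)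
  then have "continuous_on S (\<lambda>y. max (f x y) (Max ((\<lambda>i. f i y) ` F)))"
    by (intro continuous_on_max) auto
  with insert show ?case by simp
qed simp

lemma continuous_on_Min_image:
  fixes f :: "'i \<Rightarrow> 'b::topological_space \<Rightarrow> real"
  assumes "finite A" "A \<noteq> {}" "\<And>i. i \<in> A \<Longrightarrow> continuous_on S (f i)"
  shows "continuous_on S (\<lambda>y. Min ((\<lambda>i. f i y) ` A))"
  using assms
proof (induction A rule: finite_ne_induct)
  case (insert x F)
  then have "continuous_on S (\<lambda>y. min (f x y) (Min ((\<lambda>i. f i y) ` F)))"
    by (intro continuous_on_min) auto
  with insert show ?case by simp
qed simp

text \<open>The length of the interval of those levels \<open>t > 0\<close> with \<open>{v \<in> V. t \<le> h v} = A\<close>.\<close>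

definition level_weight :: "'v set \<Rightarrow> ('v \<Rightarrow> real) \<Rightarrow> 'v set \<Rightarrow> real" where
  "level_weight V h A = max 0 (Min (h ` A) - Max (insert 0 (h ` (V - A))))"

lemma continuous_on_level_weight:
  fixes p :: "'v \<Rightarrow> 'b::topological_space \<Rightarrow> real"
  assumes "finite V" "A \<subseteq> V" "A \<noteq> {}" "\<And>v. v \<in> V \<Longrightarrow> continuous_on S (p v)"
  shows "continuous_on S (\<lambda>y. level_weight V (\<lambda>v. p v y) A)"
proof -
  have fin: "finite A" "finite (V - A)"
    using assms(1,2) by (auto intro: finite_subset)
  have Min: "continuous_on S (\<lambda>y. Min ((\<lambda>v. p v y) ` A))"
    using fin assms by (intro continuous_on_Min_image) auto
  have "continuous_on S (\<lambda>y. Max (insert 0 ((\<lambda>v. p v y) ` (V - A))))"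
  proof (cases "V - A = {}")
    case False
    then have "continuous_on S (\<lambda>y. max 0 (Max ((\<lambda>v. p v y) ` (V - A))))"
      using fin assms by (intro continuous_on_max continuous_on_Max_image) auto
    then show ?thesis using False fin by simp
  next
    case True
    show ?thesis unfolding True by simp
  qed
  with Min show ?thesis
    unfolding level_weight_def by (intro continuous_intros)
qed

lemma finite_chain_subset_Union_mem:
  assumes "finite \<C>" "\<C> \<noteq> {}" "chain\<^sub>\<subseteq> \<C>"
  shows "\<Union>\<C> \<in> \<C>"
proof -
  have "subset.chain \<C> \<C>"
    using assms(3) unfolding chain_subset_def subset_chain_def by auto
  with assms show ?thesis by (metis Union_in_chain)
qed

lemma finite_chain_subset_Inter_mem:
  assumes "finite \<C>" "\<C> \<noteq> {}" "chain\<^sub>\<subseteq> \<C>"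
  shows "\<Inter>\<C> \<in> \<C>"
proof -
  have "subset.chain \<C> \<C>"
    using assms(3) unfolding chain_subset_def subset_chain_def by auto
  with assms show ?thesis by (metis Inter_in_chain)
qed

text \<open>The minimum of the sum over \<open>A\<close> is the total weight of the members
  containing \<open>A\<close>, attained at a point of \<open>A\<close> in no smaller member. The
  maximum outside \<open>A\<close>, or 0, is the total weight of the strictly larger members. The
  difference is \<open>c A\<close>.\<close>

lemma level_weight_chain_mem:
  fixes c :: "'v set \<Rightarrow> real"
  assumes V: "finite V" "\<C> \<subseteq> Pow V" "{} \<notin> \<C>" and ch: "chain\<^sub>\<subseteq> \<C>"
    and c: "\<And>B. B \<in> \<C> \<Longrightarrow> 0 \<le> c B" and A: "A \<in> \<C>"
  shows "level_weight V (\<lambda>v. \<Sum>B | B \<in> \<C> \<and> v \<in> B. c B) A = c A"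
proof -
  let ?h = "\<lambda>v. \<Sum>B | B \<in> \<C> \<and> v \<in> B. c B"
  have fC: "finite \<C>" using V by (meson finite_Pow_iff finite_subset)
  have cmp: "B \<subseteq> B' \<or> B' \<subseteq> B" if "B \<in> \<C>" "B' \<in> \<C>" for B B'
    using ch that by (auto simp: chain_subset_def)
  have sub: "chain\<^sub>\<subseteq> \<D>" if "\<D> \<subseteq> \<C>" for \<D>
    using ch that by (auto simp: chain_subset_def)
  have AV: "A \<subseteq> V" "A \<noteq> {}" "finite A" using A V by (auto intro: finite_subset)
  \<comment> \<open>A nonempty finite chain contains its union, so the members properly below
    \<open>A\<close> do not cover \<open>A\<close>.\<close>
  have "\<exists>a\<in>A. \<forall>B\<in>\<C>. a \<in> B \<longrightarrow> A \<subseteq> B"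
  proof -
    let ?D = "{B \<in> \<C>. B \<subset> A}"
    have "\<Union>?D \<noteq> A"
    proof (cases "?D = {}")
      case False
      then have "\<Union>?D \<in> ?D" using fC by (intro finite_chain_subset_Union_mem sub) auto
      then show ?thesis by blast
    qed (use AV in auto)
    then obtain a where "a \<in> A" "a \<notin> \<Union>?D" by blast
    then show ?thesis using cmp[OF A] by blast
  qed
  then obtain a where a: "a \<in> A" "\<And>B. B \<in> \<C> \<Longrightarrow> a \<in> B \<Longrightarrow> A \<subseteq> B" by blast
  let ?U = "{B \<in> \<C>. A \<subseteq> B}" and ?W = "{B \<in> \<C>. A \<subset> B}"
  have ha: "?h a = sum c ?U" using a by (intro sum.cong) auto
  have "Min (?h ` A) = ?h a"
  proof (rule Min_eqI)
    fix y assume "y \<in> ?h ` A"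
    then obtain b where b: "b \<in> A" "y = ?h b" by blast
    show "?h a \<le> y" unfolding b(2) ha
      using fC b c by (intro sum_mono2) auto
  qed (use a AV in auto)
  moreover have "Max (insert 0 (?h ` (V - A))) = sum c ?W"
  proof (rule Max_eqI)
    fix y assume y: "y \<in> insert 0 (?h ` (V - A))"
    show "y \<le> sum c ?W"
    proof (cases "y = 0")
      case False
      with y obtain v where v: "v \<in> V - A" "y = ?h v" by blast
      show ?thesis unfolding v(2)
        using fC v c cmp[OF A] by (intro sum_mono2) auto
    qed (use c in \<open>auto intro: sum_nonneg\<close>)
  next
    show "sum c ?W \<in> insert 0 (?h ` (V - A))"
    \<comment> \<open>If no member lies above \<open>A\<close>, the inserted 0 is the value sought.
      Otherwise \<open>\<Inter>?W\<close> is the next larger member, and a point of it outside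
      \<open>A\<close> lies in exactly the members of \<open>?W\<close>.\<close>
    proof (cases "?W = {}")
      case True
      then show ?thesis by (simp only: sum.empty insertI1)
    next
      case False
      then have *: "\<Inter>?W \<in> ?W" using fC by (intro finite_chain_subset_Inter_mem sub) simp_all
      then obtain v where v: "v \<in> \<Inter>?W" "v \<notin> A" by blast
      moreover have "\<Inter>?W \<in> \<C>" using * by simp
      ultimately have "v \<in> V" using V(2) by (meson PowD subsetD)
      moreover have "?h v = sum c ?W"
        using v cmp[OF A] by (intro sum.cong) auto
      ultimately show ?thesis using v by (intro insertI2 image_eqI[of _ _ v]) auto
    qed
  qed (simp add: V(1))
  moreover have "sum c ?U = c A + sum c ?W"
  proof -
    have "?U = insert A ?W" using A by auto
    then show ?thesis using fC by simp
  qed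
  ultimately show ?thesis using ha c[OF A] by (simp add: level_weight_def)
qed

text \<open>A nonzero weight opens a gap: on \<open>A\<close> the sum exceeds 0 and all its values
  on \<open>V - A\<close>. With positive coefficients such a set belongs to the chain; it is the
  smallest member containing a point \<open>a\<close> where the minimum over \<open>A\<close> is
  attained.\<close>

lemma level_weight_chain_nonmem:
  fixes c :: "'v set \<Rightarrow> real"
  assumes V: "finite V" "\<C> \<subseteq> Pow V" and ch: "chain\<^sub>\<subseteq> \<C>"
    and c: "\<And>B. B \<in> \<C> \<Longrightarrow> 0 < c B" and A: "A \<subseteq> V" "A \<noteq> {}" "A \<notin> \<C>"
  shows "level_weight V (\<lambda>v. \<Sum>B | B \<in> \<C> \<and> v \<in> B. c B) A = 0"
proof (rule ccontr)
  let ?h = "\<lambda>v. \<Sum>B | B \<in> \<C> \<and> v \<in> B. c B"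
  assume "level_weight V ?h A \<noteq> 0"
  then have lt: "Max (insert 0 (?h ` (V - A))) < Min (?h ` A)"
    by (auto simp: level_weight_def max_def split: if_splits)
  have fin: "finite A" "finite \<C>" using A V by (meson finite_Pow_iff finite_subset)+
  have cmp: "B \<subseteq> B' \<or> B' \<subseteq> B" if "B \<in> \<C>" "B' \<in> \<C>" for B B'
    using ch that by (auto simp: chain_subset_def)
  have "Min (?h ` A) \<in> ?h ` A" using fin A by (intro Min_in) auto
  then obtain a where a: "a \<in> A" "Min (?h ` A) = ?h a" by blast
  have out: "?h v < ?h a" if "v \<in> V - A" for v
    using lt that V(1) unfolding a(2) by (subst (asm) Max_less_iff) auto
  have pos: "0 < ?h a"
    using lt V(1) unfolding a(2) by (subst (asm) Max_less_iff) auto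
  have mn: "?h a \<le> ?h b" if "b \<in> A" for b
    using that fin unfolding a(2)[symmetric] by (intro Min_le) auto
  let ?D = "{B \<in> \<C>. a \<in> B}"
  have "?D \<noteq> {}" using pos by (metis less_irrefl sum.empty)
  then have B0: "\<Inter>?D \<in> ?D"
    using fin ch by (intro finite_chain_subset_Inter_mem) (auto simp: chain_subset_def)
  have "A \<subseteq> \<Inter>?D"
  proof
    fix b assume b: "b \<in> A"
    show "b \<in> \<Inter>?D"
    proof (rule ccontr)
      assume nb: "b \<notin> \<Inter>?D"
      \<comment> \<open>A member containing \<open>b\<close> is not below \<open>\<Inter>?D\<close>,
        hence contains \<open>a\<close>; the positive coefficient of \<open>\<Inter>?D\<close>
        counts for \<open>a\<close> only. This contradicts the minimality of \<open>a\<close> on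
        \<open>A\<close>.\<close>
      have "?h b < ?h a"
      proof (rule sum_strict_mono2[where b = "\<Inter>?D"])
        show "{B \<in> \<C>. b \<in> B} \<subseteq> ?D"
        proof safe
          fix B assume "B \<in> \<C>" "b \<in> B"
          then show "a \<in> B" using cmp[of B "\<Inter>?D"] B0 nb by blast
        qed
      qed (use B0 nb c fin in \<open>auto intro: less_imp_le\<close>)
      with mn[OF b] show False by simp
    qed
  qed
  moreover have "\<Inter>?D \<subseteq> A"
  proof
    fix v assume v: "v \<in> \<Inter>?D"
    have "?h a \<le> ?h v"
      using v c fin by (intro sum_mono2) (auto intro: less_imp_le)
    moreover have "\<Inter>?D \<in> \<C>" using B0 by simp
    then have "v \<in> V" using v V(2) by (meson PowD subsetD)
    ultimately show "v \<in> A" using out[of v] by (meson DiffI not_less)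
  qed
  ultimately have "A = \<Inter>?D" by blast
  with B0 A(3) show False by simp
qed

text \<open>Peeling: the smallest positive value \<open>m\<close> is subtracted on the whole
  support, which joins the chain as its largest member with coefficient \<open>m\<close>; the
  support of the remainder is strictly smaller. It serves the surjectivity of the placement, as the
  level weights serve its inversion.\<close>

lemma layer_decomposition:
  fixes h :: "'v \<Rightarrow> real"
  assumes "finite {v. h v \<noteq> 0}" "\<And>v. 0 \<le> h v"
  obtains c :: "'v set \<Rightarrow> real" and \<C> where "\<C> \<subseteq> Pow {v. h v \<noteq> 0} - {{}}" "chain\<^sub>\<subseteq> \<C>"
    "\<And>B. B \<in> \<C> \<Longrightarrow> 0 < c B" "\<And>v. h v = (\<Sum>B | B \<in> \<C> \<and> v \<in> B. c B)"
  using assms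
proof (induction "card {v. h v \<noteq> 0}" arbitrary: h thesis rule: less_induct)
  case less
  let ?S = "{v. h v \<noteq> 0}"
  show ?case
  proof (cases "?S = {}")
    case True
    then show ?thesis by (intro less.prems(1)[of "{}"]) (auto simp: chain_subset_def)
  next
    case False
    define m where "m = Min (h ` ?S)"
    define h' where "h' = (\<lambda>v. if v \<in> ?S then h v - m else 0)"
    let ?S' = "{v. h' v \<noteq> 0}"
    have "m \<in> h ` ?S" unfolding m_def using False less.prems(2) by (intro Min_in) auto
    then obtain a where a: "a \<in> ?S" "m = h a" by blast
    have m: "0 < m" using a less.prems(3)[of a] by auto
    have mle: "m \<le> h v" if "v \<in> ?S" for v
      unfolding m_def using less.prems(2) that by (intro Min_le) auto
    have sub: "?S' \<subset> ?S"
    proof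
      show "?S' \<subseteq> ?S" by (auto simp: h'_def)
      have "a \<notin> ?S'" by (simp add: h'_def a(2))
      then show "?S' \<noteq> ?S" using a(1) by blast
    qed
    have fS': "finite ?S'" using sub less.prems(2) by (meson finite_subset psubset_imp_subset)
    have pos: "0 \<le> h' v" for v using mle by (simp add: h'_def)
    have "card ?S' < card ?S" using sub less.prems(2) by (rule psubset_card_mono[rotated])
    then obtain c \<C> where IH: "\<C> \<subseteq> Pow ?S' - {{}}" "chain\<^sub>\<subseteq> \<C>"
      "\<And>B. B \<in> \<C> \<Longrightarrow> 0 < c B" "\<And>v. h' v = (\<Sum>B | B \<in> \<C> \<and> v \<in> B. c B)"
      using less.hyps[of h', OF _ _ fS' pos] by blast
    have fC: "finite \<C>" using IH(1) fS' by (meson Diff_subset finite_Pow_iff finite_subset)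
    have nS: "?S \<notin> \<C>" using IH(1) sub by blast
    show ?thesis
    proof (rule less.prems(1)[of "insert ?S \<C>" "c(?S := m)"])
      show "insert ?S \<C> \<subseteq> Pow ?S - {{}}" using False IH(1) sub by auto
      show "chain\<^sub>\<subseteq> (insert ?S \<C>)"
        using IH(1,2) sub unfolding chain_subset_def by blast
      show "0 < (c(?S := m)) B" if "B \<in> insert ?S \<C>" for B
        using that m IH(3) by auto
      show "h v = (\<Sum>B | B \<in> insert ?S \<C> \<and> v \<in> B. (c(?S := m)) B)" for v
      proof -
        have eq: "(\<Sum>B | B \<in> \<C> \<and> v \<in> B. (c(?S := m)) B) = h' v"
          unfolding IH(4) using nS by (intro sum.cong) auto
        show ?thesis
        proof (cases "v \<in> ?S")
          case True
          then have "{B. B \<in> insert ?S \<C> \<and> v \<in> B} = insert ?S {B. B \<in> \<C> \<and> v \<in> B}" by auto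
          then have "(\<Sum>B | B \<in> insert ?S \<C> \<and> v \<in> B. (c(?S := m)) B)
              = m + (\<Sum>B | B \<in> \<C> \<and> v \<in> B. (c(?S := m)) B)"
            using nS fC by simp
          then show ?thesis using True unfolding eq by (simp add: h'_def)
        next
          case False
          then have "{B. B \<in> insert ?S \<C> \<and> v \<in> B} = {B. B \<in> \<C> \<and> v \<in> B}" by auto
          then show ?thesis using False eq by (simp add: h'_def)
        qed
      qed
    qed
  qed
qed

section \<open>Strict total order on equinumerous sets\<close>

text \<open>\<open>set_lex_less\<close> quantifies existentially over enumerations; uniqueness lets
  two such statements be compared on the same pair of lists. Different heads would each have to
  precede the other.\<close>

lemma sorted_wrt_set_unique:
  assumes "asymp_on (set xs) R" "sorted_wrt R xs" "sorted_wrt R ys" "set xs = set ys"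
  shows "xs = ys"
  using assms
proof (induction xs arbitrary: ys)
  case (Cons x xs)
  obtain y zs where ys: "ys = y # zs" using Cons.prems(4) by (cases ys) auto
  have nR: "\<not> R u u" if "u \<in> set (x # xs)" for u
    using Cons.prems(1) that by (auto simp: asymp_on_def)
  have xy: "x = y"
  proof (rule ccontr)
    assume "x \<noteq> y"
    then have "x \<in> set zs" "y \<in> set xs" using Cons.prems(4) ys by auto
    then have "R x y" "R y x" using Cons.prems(2,3) ys by auto
    then show False using Cons.prems(1) \<open>y \<in> set xs\<close> by (auto simp: asymp_on_def)
  qed
  moreover have "x \<notin> set xs" "y \<notin> set zs"
    using nR Cons.prems(2,3,4) ys by fastforce+
  ultimately have "set xs = set zs" using Cons.prems(4) ys by auto
  moreover have "asymp_on (set xs) R" using Cons.prems(1) by (auto simp: asymp_on_def)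
  ultimately show ?case using Cons xy ys by auto
qed auto

lemma ex_least_total_on:
  assumes "finite A" "A \<noteq> {}" "total_on A r" "trans r"
  shows "\<exists>a\<in>A. \<forall>b\<in>A. b \<noteq> a \<longrightarrow> (a, b) \<in> r"
  using assms
proof (induction A rule: finite_ne_induct)
  case (insert x F)
  then obtain a where a: "a \<in> F" "\<forall>b\<in>F. b \<noteq> a \<longrightarrow> (a, b) \<in> r"
    by (auto simp: total_on_def)
  with insert have "(a, x) \<in> r \<or> (x, a) \<in> r" by (auto simp: total_on_def)
  then show ?case
  proof
    assume "(x, a) \<in> r"
    then have "\<forall>b\<in>insert x F. b \<noteq> x \<longrightarrow> (x, b) \<in> r"
      using a insert.prems(2) by (auto dest: transD)
    then show ?thesis by blast
  qed (use a in auto)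
qed auto

text \<open>The length equation says that nothing is repeated, so that equinumerous sets receive
  lists of equal length, as \<open>lexord_total_on\<close> demands.\<close>

lemma ex_sorted_wrt_linear_order:
  assumes lin: "linear_order_on V r" and "finite A" "A \<subseteq> V"
  shows "\<exists>xs. set xs = A \<and> sorted_wrt (\<lambda>x y. (x, y) \<in> r - Id) xs \<and> length xs = card A"
  using assms(2,3)
proof (induction "card A" arbitrary: A)
  case 0
  then show ?case by (intro exI[of _ "[]"]) auto
next
  case (Suc n)
  have *: "trans r" "total_on V r"
    using lin by (auto simp: linear_order_on_def partial_order_on_def preorder_on_def)
  have "\<exists>a\<in>A. \<forall>b\<in>A. b \<noteq> a \<longrightarrow> (a, b) \<in> r"
  proof (rule ex_least_total_on)
    show "A \<noteq> {}" using Suc.hyps(2) by auto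
    show "total_on A r" using *(2) \<open>A \<subseteq> V\<close> by (rule total_on_subset)
  qed (use Suc.prems * in auto)
  then obtain a where a: "a \<in> A" "\<forall>b\<in>A. b \<noteq> a \<longrightarrow> (a, b) \<in> r" by blast
  have "n = card (A - {a})" using Suc a by (simp add: card_Diff_singleton)
  moreover have "finite (A - {a})" "A - {a} \<subseteq> V" using Suc.prems by auto
  ultimately obtain xs where xs: "set xs = A - {a}" "sorted_wrt (\<lambda>x y. (x, y) \<in> r - Id) xs"
    "length xs = card (A - {a})"
    using Suc.hyps(1) by blast
  moreover have "\<forall>b\<in>A - {a}. (a, b) \<in> r - Id" using a by auto
  moreover have "length (a # xs) = card A" using xs(3) Suc.hyps(2) \<open>n = card (A - {a})\<close> by simp
  moreover have "insert a (A - {a}) = A" using a(1) by blast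
  ultimately show ?case
    by (intro exI[of _ "a # xs"] conjI) (simp_all only: list.set sorted_wrt.simps simp_thms)
qed

lemma lexord_total_on:
  assumes "total_on V R" "set xs \<subseteq> V" "set ys \<subseteq> V" "length xs = length ys" "xs \<noteq> ys"
  shows "(xs, ys) \<in> lexord R \<or> (ys, xs) \<in> lexord R"
  using assms(4,2,3,5)
proof (induction xs ys rule: list_induct2)
  case (Cons x xs y ys)
  then show ?case using assms(1) by (cases "x = y") (auto simp: total_on_def)
qed auto

lemma set_prec_total:
  assumes "linear_order_on V r" "finite A" "finite B" "A \<subseteq> V" "B \<subseteq> V" "A \<noteq> B"
  shows "set_prec r A B \<or> set_prec r B A"
proof (cases "card A = card B")
  case True
  obtain xs where xs: "set xs = A" "sorted_wrt (\<lambda>x y. (x, y) \<in> r - Id) xs" "length xs = card A"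
    using ex_sorted_wrt_linear_order assms by metis
  obtain ys where ys: "set ys = B" "sorted_wrt (\<lambda>x y. (x, y) \<in> r - Id) ys" "length ys = card B"
    using ex_sorted_wrt_linear_order assms by metis
  have "total_on V (r - Id)"
    using assms(1) by (auto simp: linear_order_on_def total_on_def)
  then have "(xs, ys) \<in> lexord (r - Id) \<or> (ys, xs) \<in> lexord (r - Id)"
    using xs ys assms True by (intro lexord_total_on[of V]) auto
  then show ?thesis using xs ys True by (auto simp: set_prec_def set_lex_less_def)
qed (auto simp: set_prec_def)

lemma set_prec_asym:
  assumes lin: "linear_order_on V r" and prec: "set_prec r A B"
  shows "\<not> set_prec r B A"
proof
  assume "set_prec r B A"
  with prec have lex: "set_lex_less r A B" "set_lex_less r B A"
    by (auto simp: set_prec_def)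
  have "antisym r"
    using lin by (auto simp: linear_order_on_def partial_order_on_def)
  then have asym: "asym (r - Id)" by (auto simp: asym_on_def antisym_def)
  then have asymp: "asymp_on (set xs) (\<lambda>x y. (x, y) \<in> r - Id)" for xs
    by (auto simp: asymp_on_def asym_on_def)
  obtain xs ys where 1: "set xs = A" "sorted_wrt (\<lambda>x y. (x, y) \<in> r - Id) xs"
    "set ys = B" "sorted_wrt (\<lambda>x y. (x, y) \<in> r - Id) ys" "(xs, ys) \<in> lexord (r - Id)"
    using lex(1) unfolding set_lex_less_def by blast
  obtain ys' xs' where 2: "set ys' = B" "sorted_wrt (\<lambda>x y. (x, y) \<in> r - Id) ys'"
    "set xs' = A" "sorted_wrt (\<lambda>x y. (x, y) \<in> r - Id) xs'" "(ys', xs') \<in> lexord (r - Id)"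
    using lex(2) unfolding set_lex_less_def by blast
  have "xs' = xs" "ys' = ys"
    using 1 2 by (metis asymp sorted_wrt_set_unique)+
  then show False using 1 2 lexord_asym[OF asym] by (auto simp: asym_on_def)
qed

text \<open>Sizes are how the order enters the geometric arguments; totality and asymmetry settle
  which member of a pair is kept.\<close>

lemma set_prec_card_le: "set_prec r A B \<Longrightarrow> card A \<le> card B"
  by (auto simp: set_prec_def)

section \<open>Affine extensions\<close>

lemma affine_extension_eq_sum:
  assumes "finite U" "{v. x v \<noteq> 0} \<subseteq> U"
  shows "affine_extension p x w = (\<Sum>v\<in>U. x v * p v w)"
  unfolding affine_extension_def using assms by (intro sum.mono_neutral_left) auto

text \<open>A convex combination of probability vectors is one again. All terms are nonnegative, so
  nothing cancels and the support is the whole union of supports rather than a part of it.\<close>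

lemma affine_extension_convex_combination:
  fixes p :: "'v \<Rightarrow> 'w \<Rightarrow> real"
  assumes x: "\<And>v. 0 \<le> x v" "finite {v. x v \<noteq> 0}"
    and p: "\<And>v w. x v \<noteq> 0 \<Longrightarrow> 0 \<le> p v w" "\<And>v. x v \<noteq> 0 \<Longrightarrow> finite {w. p v w \<noteq> 0}"
      "\<And>v. x v \<noteq> 0 \<Longrightarrow> (\<Sum>w | p v w \<noteq> 0. p v w) = 1"
  shows "0 \<le> affine_extension p x w"
    and "{w. affine_extension p x w \<noteq> 0} = (\<Union>v\<in>{v. x v \<noteq> 0}. {w. p v w \<noteq> 0})"
    and "(\<Sum>w | affine_extension p x w \<noteq> 0. affine_extension p x w) = (\<Sum>v | x v \<noteq> 0. x v)"
proof -
  let ?S = "{v. x v \<noteq> 0}"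
  let ?T = "\<Union>v\<in>?S. {w. p v w \<noteq> 0}"
  show "0 \<le> affine_extension p x w"
    unfolding affine_extension_def using x(1) p(1) by (intro sum_nonneg) auto
  show supp: "{w. affine_extension p x w \<noteq> 0} = ?T"
    unfolding affine_extension_def using x p(1)
    by (subst sum_nonneg_eq_0_iff) auto
  have fT: "finite ?T" using x(2) p(2) by auto
  have "(\<Sum>w\<in>?T. affine_extension p x w) = (\<Sum>v\<in>?S. x v * (\<Sum>w\<in>?T. p v w))"
    unfolding affine_extension_def by (subst sum.swap) (simp add: sum_distrib_left)
  also have "\<dots> = (\<Sum>v\<in>?S. x v * 1)"
  proof (rule sum.cong[OF refl])
    fix v assume v: "v \<in> ?S"
    have "(\<Sum>w\<in>?T. p v w) = (\<Sum>w | p v w \<noteq> 0. p v w)"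
      using fT v by (intro sum.mono_neutral_right) auto
    then show "x v * (\<Sum>w\<in>?T. p v w) = x v * 1" using p(3) v by simp
  qed
  finally show "(\<Sum>w | affine_extension p x w \<noteq> 0. affine_extension p x w) = (\<Sum>v | x v \<noteq> 0. x v)"
    unfolding supp by simp
qed

lemma barycenter_nonneg: "0 \<le> barycenter \<sigma> v"
  by (simp add: barycenter_def)

lemma barycenter_support: "finite \<sigma> \<Longrightarrow> {v. barycenter \<sigma> v \<noteq> 0} = \<sigma>"
  by (auto simp: barycenter_def indicator_def)

lemma barycenter_sum: "finite \<sigma> \<Longrightarrow> \<sigma> \<noteq> {} \<Longrightarrow> (\<Sum>v | barycenter \<sigma> v \<noteq> 0. barycenter \<sigma> v) = 1"
  unfolding barycenter_support by (simp add: barycenter_def)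

lemma barycenter_image: "inj f \<Longrightarrow> barycenter (f ` \<sigma>) (f v) = barycenter \<sigma> v"
  by (simp add: barycenter_def card_image inj_on_subset indicator_def inj_image_mem_iff)

text \<open>Functoriality, by exchanging two finite sums. As \<open>f\<close> may identify vertices,
  a coordinate of the pushed point collects a whole fibre.\<close>

lemma affine_extension_realization_map:
  assumes fin: "finite {v. x v \<noteq> 0}"
  shows "affine_extension p (realization_map f x) = affine_extension (p \<circ> f) x"
proof
  fix w
  let ?S = "{v. x v \<noteq> 0}"
  have rm: "realization_map f x t = (\<Sum>v\<in>?S. x v * indicator {f v} t)" for t
    by (simp add: realization_map_def affine_extension_def barycenter_def)
  have "affine_extension p (realization_map f x) w
      = (\<Sum>t\<in>f ` ?S. (\<Sum>v\<in>?S. x v * indicator {f v} t) * p t w)"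
    unfolding rm[symmetric]
  proof (rule affine_extension_eq_sum)
    show "{t. realization_map f x t \<noteq> 0} \<subseteq> f ` ?S"
    proof (rule subsetI, rule ccontr)
      fix t assume t: "t \<in> {t. realization_map f x t \<noteq> 0}" "t \<notin> f ` ?S"
      then have "realization_map f x t = 0"
        unfolding rm by (intro sum.neutral) (auto simp: indicator_def)
      with t show False by simp
    qed
  qed (use fin in auto)
  also have "\<dots> = (\<Sum>v\<in>?S. \<Sum>t\<in>f ` ?S. x v * (indicator {f v} t * p t w))"
    by (subst sum.swap) (simp add: sum_distrib_right mult.assoc)
  also have "\<dots> = (\<Sum>v\<in>?S. x v * p (f v) w)"
  proof (rule sum.cong[OF refl])
    fix v assume "v \<in> ?S"
    then have "(\<Sum>t\<in>f ` ?S. x v * (indicator {f v} t * p t w))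
        = (\<Sum>t\<in>f ` ?S. if t = f v then x v * p t w else 0)"
      by (intro sum.cong) (auto simp: indicator_def)
    also have "\<dots> = x v * p (f v) w"
      using fin \<open>v \<in> ?S\<close> by (subst sum.delta) auto
    finally show "(\<Sum>t\<in>f ` ?S. x v * (indicator {f v} t * p t w)) = x v * p (f v) w" .
  qed
  finally show "affine_extension p (realization_map f x) w = affine_extension (p \<circ> f) x w"
    by (simp add: affine_extension_def)
qed

lemma realization_map_support:
  assumes "\<And>v. 0 \<le> x v" "finite {v. x v \<noteq> 0}" "(\<Sum>v | x v \<noteq> 0. x v) = 1"
  shows "0 \<le> realization_map f x w"
    and "{w. realization_map f x w \<noteq> 0} = f ` {v. x v \<noteq> 0}"
    and "(\<Sum>w | realization_map f x w \<noteq> 0. realization_map f x w) = 1"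
proof -
  have p: "0 \<le> barycenter {f v} w" "finite {w. barycenter {f v} w \<noteq> 0}"
    "(\<Sum>w | barycenter {f v} w \<noteq> 0. barycenter {f v} w) = 1" for v w
    using barycenter_sum[of "{f v}"] by (simp_all add: barycenter_nonneg barycenter_support)
  note * = affine_extension_convex_combination[of x "\<lambda>v. barycenter {f v}", OF assms(1,2) p, unfolded assms(3)]
  show "0 \<le> realization_map f x w" "(\<Sum>w | realization_map f x w \<noteq> 0. realization_map f x w) = 1"
    unfolding realization_map_def by (fact *)+
  show "{w. realization_map f x w \<noteq> 0} = f ` {v. x v \<noteq> 0}"
    unfolding realization_map_def *(2) by (auto simp: barycenter_support)
qed

text \<open>This is how a common carrier is used: sums over varying supports become sums over
  \<open>\<sigma>\<close>, where both totals are 1. All faces of \<open>\<sigma>\<close> must be in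
  \<open>K\<close>, since the support on the way is some subset of \<open>\<sigma>\<close>.\<close>

lemma realization_convex:
  assumes x: "x \<in> realization K" and y: "y \<in> realization K" and t: "t \<in> {0..1}"
    and \<sigma>: "finite \<sigma>" "{v. x v \<noteq> 0} \<subseteq> \<sigma>" "{v. y v \<noteq> 0} \<subseteq> \<sigma>"
    and K: "\<And>\<tau>. \<tau> \<subseteq> \<sigma> \<Longrightarrow> \<tau> \<in> K"
  shows "(\<lambda>v. (1 - t) * x v + t * y v) \<in> realization K"
proof -
  let ?z = "\<lambda>v. (1 - t) * x v + t * y v"
  have sum: "(\<Sum>v | f v \<noteq> 0. f v) = (\<Sum>v\<in>\<sigma>. f v)" if "{v. f v \<noteq> 0} \<subseteq> \<sigma>" for f :: "'a \<Rightarrow> real"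
    using \<sigma>(1) that by (intro sum.mono_neutral_left) auto
  have z: "{v. ?z v \<noteq> 0} \<subseteq> \<sigma>"
  proof
    fix v assume "v \<in> {v. ?z v \<noteq> 0}"
    then have "x v \<noteq> 0 \<or> y v \<noteq> 0" by auto
    then show "v \<in> \<sigma>" using \<sigma>(2,3) by auto
  qed
  have "sum x \<sigma> = 1" "sum y \<sigma> = 1"
    using x y sum[OF \<sigma>(2)] sum[OF \<sigma>(3)] by (auto simp: realization_def)
  then have "(\<Sum>v\<in>\<sigma>. ?z v) = 1"
    by (simp add: sum.distrib flip: sum_distrib_left)
  moreover have "0 \<le> ?z v" for v using x y t by (simp add: realization_def)
  ultimately show ?thesis using K[OF z] sum[OF z] by (simp add: realization_def)
qed

section \<open>Swapping the shores\<close>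

lemma swap_shores_swap_shores [simp]: "swap_shores (swap_shores s) = s"
  by (cases s) (auto simp: swap_shores_def)

lemma swap_shores_simps [simp]: "swap_shores (Inl a) = Inr a" "swap_shores (Inr a) = Inl a"
  by (auto simp: swap_shores_def)

lemma inj_swap_shores: "inj swap_shores"
  by (metis injI swap_shores_swap_shores)

lemma swap_shores_image: "swap_shores ` (A <+> B) = B <+> A"
  by (force simp: Plus_def image_Un image_image)

lemma sum_swap_shores:
  assumes "\<And>s. s \<in> swap_shores ` T \<Longrightarrow> f s = g (swap_shores s)"
  shows "sum f (swap_shores ` T) = sum g T"
  using assms by (subst sum.reindex) (auto intro: inj_on_subset[OF inj_swap_shores])

lemma support_swap_shores: "{s. x (swap_shores s) \<noteq> 0} = swap_shores ` {s. x s \<noteq> 0}"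
  by (force intro: image_eqI[of _ _ "swap_shores _"])

text \<open>Pushing coordinates forward along a bijection is precomposing with its inverse, and the
  swap is its own inverse. This lets the action be handled as
  \<open>x \<circ> swap_shores\<close>.\<close>

lemma realization_map_swap_shores:
  assumes "finite {s. x s \<noteq> 0}"
  shows "realization_map swap_shores x = x \<circ> swap_shores"
proof
  fix s
  have "realization_map swap_shores x s = (\<Sum>v | x v \<noteq> 0. x v * indicator {swap_shores v} s)"
    by (simp add: realization_map_def affine_extension_def barycenter_def)
  also have "\<dots> = (\<Sum>v | x v \<noteq> 0. if v = swap_shores s then x v else 0)"
    by (intro sum.cong) (auto simp: indicator_def)
  also have "\<dots> = x (swap_shores s)" using assms by (subst sum.delta) auto
  finally show "realization_map swap_shores x s = (x \<circ> swap_shores) s" by simp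
qed

lemma shore_simplex_swap_shores: "shore_simplex (swap_shores s) = swap_shores ` shore_simplex s"
  by (cases s) (auto simp: shore_simplex_def swap_shores_image)

lemma barycenter_shore_simplex_swap:
  "barycenter (shore_simplex (swap_shores s)) w = barycenter (shore_simplex s) (swap_shores w)"
  using barycenter_image[OF inj_swap_shores, of "shore_simplex s" "swap_shores w"]
  by (simp add: shore_simplex_swap_shores)

lemma shore_placement_swap_shores:
  "shore_placement (x \<circ> swap_shores) = shore_placement x \<circ> swap_shores"
proof
  fix w
  show "shore_placement (x \<circ> swap_shores) w = (shore_placement x \<circ> swap_shores) w"
    unfolding shore_placement_def affine_extension_def comp_def support_swap_shores
    by (rule sum_swap_shores) (simp add: barycenter_shore_simplex_swap)
qed

text \<open>Vertices of the second shore contribute nothing here. On one shore the placement is thus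
  a layer-cake sum with coefficients \<open>x (Inl A) / card A\<close>, the form that the level
  weights invert.\<close>

lemma shore_placement_Inl:
  assumes "finite {s. x s \<noteq> 0}"
  shows "shore_placement x (Inl v)
    = (\<Sum>A | A \<in> {A. x (Inl A) \<noteq> 0} \<and> v \<in> A. x (Inl A) / real (card A))"
proof -
  have b: "barycenter (shore_simplex s) (Inl v)
      = (case s of Inl A \<Rightarrow> indicator A v / real (card A) | Inr A \<Rightarrow> 0)" for s
    by (cases s) (auto simp: barycenter_def shore_simplex_def indicator_def Plus_def card_image)
  have "shore_placement x (Inl v)
      = (\<Sum>s \<in> Inl ` {A. x (Inl A) \<noteq> 0 \<and> v \<in> A}. x s * barycenter (shore_simplex s) (Inl v))"
    unfolding shore_placement_def affine_extension_def
    using assms by (intro sum.mono_neutral_right) (auto simp: b split: sum.splits)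
  also have "\<dots> = (\<Sum>A | x (Inl A) \<noteq> 0 \<and> v \<in> A. x (Inl A) / real (card A))"
    by (subst sum.reindex) (auto intro!: sum.cong simp: b)
  finally show ?thesis by simp
qed

lemma shore_placement_Inr:
  assumes "finite {s. x s \<noteq> 0}"
  shows "shore_placement x (Inr v)
    = (\<Sum>A | A \<in> {A. x (Inr A) \<noteq> 0} \<and> v \<in> A. x (Inr A) / real (card A))"
proof -
  have "finite {s. (x \<circ> swap_shores) s \<noteq> 0}"
    using assms by (simp add: support_swap_shores)
  from shore_placement_Inl[OF this, of v] show ?thesis
    unfolding shore_placement_swap_shores by simp
qed

text \<open>The left inverse of \<open>shore_placement\<close>. The factor \<open>card A\<close>
  undoes the denominator of the barycenter; for \<open>A = {}\<close> it is 0 and hides the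
  unspecified minimum of the empty set.\<close>

definition shore_coords :: "'a set \<Rightarrow> ('a + 'a \<Rightarrow> real) \<Rightarrow> 'a set + 'a set \<Rightarrow> real" where
  "shore_coords V y = case_sum (\<lambda>A. card A * level_weight V (\<lambda>v. y (Inl v)) A)
     (\<lambda>A. card A * level_weight V (\<lambda>v. y (Inr v)) A)"

lemma shore_coords_swap_shores:
  "shore_coords V (y \<circ> swap_shores) s = shore_coords V y (swap_shores s)"
  by (cases s) (simp_all add: shore_coords_def)

lemma continuous_on_shore_coords:
  assumes "finite V" "s \<in> Pow V <+> Pow V"
  shows "continuous_on S (\<lambda>y. shore_coords V y s)"
proof -
  have c: "continuous_on S (\<lambda>y. card A * level_weight V (\<lambda>v. y (j v)) A)"
    if "A \<subseteq> V" for A and j :: "'a \<Rightarrow> 'a + 'a"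
  proof (cases "A = {}")
    case False
    with that assms(1) show ?thesis
      by (intro continuous_on_mult continuous_on_const continuous_on_level_weight)
        (auto intro: continuous_on_subset[OF continuous_on_product_coordinates])
  qed simp
  show ?thesis using assms(2) by (cases s) (auto simp: shore_coords_def intro: c)
qed

section \<open>The shore subdivision as a flag complex\<close>

text \<open>The edge relation of the flag complex. In both mixed cases it is the second-shore set
  that stands under \<open>CN\<close>, which makes symmetry immediate; invariance under the swap
  then rests on \<open>subset_CN_sym\<close>.\<close>

fun shore_compat :: "'a pair_pre_digraph \<Rightarrow> 'a set + 'a set \<Rightarrow> 'a set + 'a set \<Rightarrow> bool" where
  "shore_compat G (Inl A) (Inl B) \<longleftrightarrow> A \<subseteq> B \<or> B \<subseteq> A"
| "shore_compat G (Inr A) (Inr B) \<longleftrightarrow> A \<subseteq> B \<or> B \<subseteq> A"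
| "shore_compat G (Inl A) (Inr B) \<longleftrightarrow> A \<subseteq> CN G B"
| "shore_compat G (Inr B) (Inl A) \<longleftrightarrow> A \<subseteq> CN G B"

lemma shore_compat_refl [simp]: "shore_compat G s s"
  by (cases s) auto

lemma shore_compat_sym: "shore_compat G s t \<longleftrightarrow> shore_compat G t s"
  by (cases s; cases t) auto

lemma vimage_Inl_Inr_Plus: "(Inl -` \<sigma>) <+> (Inr -` \<sigma>) = \<sigma>"
proof -
  have "s \<in> (Inl -` \<sigma>) <+> (Inr -` \<sigma>) \<longleftrightarrow> s \<in> \<sigma>" for s by (cases s) auto
  then show ?thesis by blast
qed

context pair_graph
begin

lemma finite_neighborhood_complex: "finite (neighborhood_complex G)"
  using pair_finite_verts
  by (auto simp: neighborhood_complex_def intro: finite_subset[of _ "Pow (pverts G)"])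

lemma CN_subset: "CN G A \<subseteq> pverts G"
  by (auto simp: CN_def)

text \<open>\<open>CN\<close> is an antitone Galois connection with itself, because the arcs are
  symmetric.\<close>

lemma subset_CN_sym: "A \<subseteq> pverts G \<Longrightarrow> B \<subseteq> pverts G \<Longrightarrow> A \<subseteq> CN G B \<longleftrightarrow> B \<subseteq> CN G A"
  using CN_antimono subset_CN2 by (metis subset_trans)

text \<open>A node of \<open>A\<close> would be adjacent to itself. This gives both the freeness of
  the action and the distinctness of \<open>A\<close> and \<open>CN G A\<close> in a pair.\<close>

lemma not_subset_CN_self: "A \<noteq> {} \<Longrightarrow> \<not> A \<subseteq> CN G A"
  using pair_no_loops by (fastforce simp: CN_def)

text \<open>Being a chain and being adjacent across the shores are conditions on pairs, and
  finiteness comes with the finite graph. Adding or moving vertices can therefore be checked pair by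
  pair.\<close>

lemma shore_subdivision_iff:
  "\<sigma> \<in> shore_subdivision G \<longleftrightarrow>
     \<sigma> \<subseteq> (neighborhood_complex G - {{}}) <+> (neighborhood_complex G - {{}}) \<and>
     (\<forall>s\<in>\<sigma>. \<forall>t\<in>\<sigma>. shore_compat G s t)" (is "_ \<longleftrightarrow> \<sigma> \<subseteq> ?W \<and> ?C \<sigma>")
proof
  assume "\<sigma> \<in> shore_subdivision G"
  then obtain \<A> \<B> where "\<sigma> = \<A> <+> \<B>"
    "\<A> \<in> barycentric_subdivision (neighborhood_complex G)"
    "\<B> \<in> barycentric_subdivision (neighborhood_complex G)"
    "\<forall>A\<in>\<A>. \<forall>B\<in>\<B>. A \<subseteq> CN G B" by (auto simp: shore_subdivision_def)
  then show "\<sigma> \<subseteq> ?W \<and> ?C \<sigma>"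
    by (auto simp: barycentric_subdivision_def chain_subset_def)
next
  assume \<sigma>: "\<sigma> \<subseteq> ?W \<and> ?C \<sigma>"
  let ?A = "Inl -` \<sigma>" and ?B = "Inr -` \<sigma>"
  have sub: "?A \<subseteq> neighborhood_complex G - {{}}" "?B \<subseteq> neighborhood_complex G - {{}}"
    using \<sigma> by auto
  have "chain\<^sub>\<subseteq> ?A" "chain\<^sub>\<subseteq> ?B"
    unfolding chain_subset_def using \<sigma> by (metis shore_compat.simps(1,2) vimageE)+
  moreover have "finite ?A" "finite ?B"
    using sub finite_neighborhood_complex by (meson Diff_subset finite_subset)+
  ultimately have "?A \<in> barycentric_subdivision (neighborhood_complex G)"
    "?B \<in> barycentric_subdivision (neighborhood_complex G)"
    using sub by (auto simp: barycentric_subdivision_def)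
  moreover have "\<forall>A\<in>?A. \<forall>B\<in>?B. A \<subseteq> CN G B"
    using \<sigma> by (metis shore_compat.simps(3) vimageE)
  ultimately show "\<sigma> \<in> shore_subdivision G"
    unfolding shore_subdivision_def mem_Collect_eq
    by (intro exI[of _ ?A] exI[of _ ?B]) (simp add: vimage_Inl_Inr_Plus)
qed

lemma shore_subdivision_subset:
  "\<sigma> \<in> shore_subdivision G \<Longrightarrow> \<sigma> \<subseteq> Pow (pverts G) <+> Pow (pverts G)"
  unfolding shore_subdivision_iff by (auto simp: neighborhood_complex_def)

lemma finite_shore_subdivision: "\<sigma> \<in> shore_subdivision G \<Longrightarrow> finite \<sigma>"
  using shore_subdivision_subset pair_finite_verts
  by (meson finite_Plus finite_Pow_iff finite_subset)

lemma neighborhood_complex_subset: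
  "A \<in> neighborhood_complex G \<Longrightarrow> B \<subseteq> A \<Longrightarrow> B \<in> neighborhood_complex G"
  using CN_antimono[of B A] by (auto simp: neighborhood_complex_def)

lemma box_complex_iff:
  "\<sigma> \<in> box_complex G \<longleftrightarrow> Inl -` \<sigma> \<in> neighborhood_complex G \<and>
     Inr -` \<sigma> \<in> neighborhood_complex G \<and> Inl -` \<sigma> \<subseteq> CN G (Inr -` \<sigma>)"
proof
  assume "\<sigma> \<in> box_complex G"
  then obtain A B where \<sigma>: "\<sigma> = A <+> B" and AB: "A \<in> neighborhood_complex G"
    "B \<in> neighborhood_complex G" "A \<subseteq> CN G B" by (auto simp: box_complex_def)
  moreover have "Inl -` \<sigma> = A" "Inr -` \<sigma> = B" using \<sigma> by auto
  ultimately show "Inl -` \<sigma> \<in> neighborhood_complex G \<and>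
     Inr -` \<sigma> \<in> neighborhood_complex G \<and> Inl -` \<sigma> \<subseteq> CN G (Inr -` \<sigma>)" by simp
next
  assume *: "Inl -` \<sigma> \<in> neighborhood_complex G \<and>
     Inr -` \<sigma> \<in> neighborhood_complex G \<and> Inl -` \<sigma> \<subseteq> CN G (Inr -` \<sigma>)"
  then have "Inr -` \<sigma> \<subseteq> CN G (Inl -` \<sigma>)"
    by (subst subset_CN_sym) (auto simp: neighborhood_complex_def)
  with * show "\<sigma> \<in> box_complex G"
    unfolding box_complex_def mem_Collect_eq
    by (intro exI[of _ "Inl -` \<sigma>"] exI[of _ "Inr -` \<sigma>"]) (simp add: vimage_Inl_Inr_Plus)
qed

lemma box_complex_subset:
  assumes "\<sigma> \<in> box_complex G" "\<tau> \<subseteq> \<sigma>"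
  shows "\<tau> \<in> box_complex G"
proof -
  have sub: "Inl -` \<tau> \<subseteq> Inl -` \<sigma>" "Inr -` \<tau> \<subseteq> Inr -` \<sigma>" using assms(2) by auto
  with assms(1) CN_antimono[OF sub(2)] show ?thesis
    unfolding box_complex_iff by (meson neighborhood_complex_subset subset_trans)
qed

lemma finite_box_complex: "\<sigma> \<in> box_complex G \<Longrightarrow> finite \<sigma>"
  using pair_finite_verts finite_subset
  by (fastforce simp: box_complex_def neighborhood_complex_def)

text \<open>On each shore the union is the largest set of a chain, so it still has a common
  neighbor.\<close>

lemma Union_shore_simplex_box:
  assumes \<sigma>: "\<sigma> \<in> shore_subdivision G" "\<sigma> \<noteq> {}"
  shows "\<Union>(shore_simplex ` \<sigma>) \<in> box_complex G"
proof -
  let ?A = "Inl -` \<sigma>" and ?B = "Inr -` \<sigma>"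
  have W: "?A \<subseteq> neighborhood_complex G - {{}}" "?B \<subseteq> neighborhood_complex G - {{}}"
    and C: "\<And>s t. s \<in> \<sigma> \<Longrightarrow> t \<in> \<sigma> \<Longrightarrow> shore_compat G s t"
    using \<sigma>(1) by (auto simp: shore_subdivision_iff)
  have ch: "chain\<^sub>\<subseteq> ?A" "chain\<^sub>\<subseteq> ?B"
    unfolding chain_subset_def using C by (metis shore_compat.simps(1,2) vimageE)+
  have fin: "finite ?A" "finite ?B"
    using W finite_neighborhood_complex by (meson Diff_subset finite_subset)+
  \<comment> \<open>One chain may be empty, with union \<open>{}\<close>. This is a simplex of the
    neighborhood complex only if \<open>G\<close> has a node, which the vertex \<open>s\<close>
    provides.\<close>
  obtain s where "s \<in> \<sigma>" using \<sigma>(2) by blast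
  then have "\<exists>A. A \<in> neighborhood_complex G" using W by (cases s) auto
  then have "CN G {} \<noteq> {}" using CN_antimono[of "{}"] by (auto simp: neighborhood_complex_def)
  then have empty: "{} \<in> neighborhood_complex G" by (simp add: neighborhood_complex_def)
  have U: "\<Union>\<C> \<in> neighborhood_complex G"
    if "finite \<C>" "chain\<^sub>\<subseteq> \<C>" "\<C> \<subseteq> neighborhood_complex G - {{}}" for \<C>
    using finite_chain_subset_Union_mem[OF that(1) _ that(2)] that(3) empty by (cases "\<C> = {}") auto
  have eq: "Inl -` (\<Union>(shore_simplex ` \<sigma>)) = \<Union>?A" "Inr -` (\<Union>(shore_simplex ` \<sigma>)) = \<Union>?B"
    by (force simp: shore_simplex_def split: sum.splits)+
  have "A \<subseteq> CN G (\<Union>?B)" if "A \<in> ?A" for A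
  proof -
    have "A \<subseteq> CN G B" if "B \<in> ?B" for B
      using C[of "Inl A" "Inr B"] that \<open>A \<in> ?A\<close> by simp
    moreover have "A \<subseteq> pverts G" using W(1) that by (auto simp: neighborhood_complex_def)
    ultimately show ?thesis by (fastforce simp: CN_def)
  qed
  then have "\<Union>?A \<subseteq> CN G (\<Union>?B)" by blast
  then show ?thesis
    unfolding box_complex_iff eq using U[OF fin(1) ch(1) W(1)] U[OF fin(2) ch(2) W(2)] by blast
qed

end

section \<open>Invariance of the complexes under the swap\<close>

lemma realization_swap_shores:
  assumes "\<And>\<sigma>. \<sigma> \<in> K \<Longrightarrow> swap_shores ` \<sigma> \<in> K" "x \<in> realization K"
  shows "x \<circ> swap_shores \<in> realization K"
proof -
  have "(\<Sum>s | x (swap_shores s) \<noteq> 0. x (swap_shores s)) = (\<Sum>s | x s \<noteq> 0. x s)"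
    unfolding support_swap_shores by (rule sum_swap_shores) simp
  then show ?thesis
    using assms by (auto simp: realization_def support_swap_shores)
qed

context pair_graph
begin

lemma shore_compat_swap_shores:
  assumes "s \<in> Pow (pverts G) <+> Pow (pverts G)" "t \<in> Pow (pverts G) <+> Pow (pverts G)"
  shows "shore_compat G (swap_shores s) (swap_shores t) \<longleftrightarrow> shore_compat G s t"
proof (cases s; cases t)
  fix A B assume "s = Inl A" "t = Inr B"
  then show ?thesis using assms subset_CN_sym[of A B] by auto
next
  fix B A assume "s = Inr B" "t = Inl A"
  then show ?thesis using assms subset_CN_sym[of A B] by auto
qed auto

lemma shore_subdivision_swap_shores:
  assumes \<sigma>: "\<sigma> \<in> shore_subdivision G"
  shows "swap_shores ` \<sigma> \<in> shore_subdivision G"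
proof -
  have "swap_shores ` \<sigma> \<subseteq> (neighborhood_complex G - {{}}) <+> (neighborhood_complex G - {{}})"
    using \<sigma> unfolding shore_subdivision_iff
    by (metis image_mono swap_shores_image)
  moreover have "shore_compat G (swap_shores s) (swap_shores t)" if "s \<in> \<sigma>" "t \<in> \<sigma>" for s t
    using \<sigma> that shore_subdivision_subset[OF \<sigma>]
    by (subst shore_compat_swap_shores) (auto simp: shore_subdivision_iff)
  ultimately show ?thesis unfolding shore_subdivision_iff by blast
qed

lemma box_complex_swap_shores:
  assumes "\<sigma> \<in> box_complex G"
  shows "swap_shores ` \<sigma> \<in> box_complex G"
proof -
  obtain A B where "\<sigma> = A <+> B" "B \<in> neighborhood_complex G" "A \<in> neighborhood_complex G"
    "B \<subseteq> CN G A" "A \<subseteq> CN G B"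
    using assms unfolding box_complex_def by blast
  then show ?thesis
    unfolding box_complex_def mem_Collect_eq
    by (intro exI[of _ B] exI[of _ A] conjI) (simp_all only: swap_shores_image)
qed

section \<open>The placement of the subdivision and its inverse\<close>

lemma shore_vertex_simplex:
  assumes "\<sigma> \<in> shore_subdivision G" "s \<in> \<sigma>"
  shows "finite (shore_simplex s)" "shore_simplex s \<noteq> {}"
proof -
  have "s \<in> (neighborhood_complex G - {{}}) <+> (neighborhood_complex G - {{}})"
    using assms by (auto simp: shore_subdivision_iff)
  then show "finite (shore_simplex s)" "shore_simplex s \<noteq> {}"
    by (auto simp: shore_simplex_def neighborhood_complex_def Plus_def
        intro!: finite_imageI intro: finite_subset[OF _ pair_finite_verts])
qed

lemma
  assumes x: "\<And>s. 0 \<le> x s" "{s. x s \<noteq> 0} \<in> shore_subdivision G"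
  shows shore_placement_nonneg: "0 \<le> shore_placement x w"
    and shore_placement_support:
      "{w. shore_placement x w \<noteq> 0} = \<Union>(shore_simplex ` {s. x s \<noteq> 0})"
    and shore_placement_sum:
      "(\<Sum>w | shore_placement x w \<noteq> 0. shore_placement x w) = (\<Sum>s | x s \<noteq> 0. x s)"
proof -
  have fin: "finite {s. x s \<noteq> 0}" using x(2) by (rule finite_shore_subdivision)
  note * = affine_extension_convex_combination[of x "\<lambda>s. barycenter (shore_simplex s)", OF x(1) fin]
  have p: "0 \<le> barycenter (shore_simplex s) w"
    "{w. barycenter (shore_simplex s) w \<noteq> 0} = shore_simplex s"
    "finite {w. barycenter (shore_simplex s) w \<noteq> 0}"
    "(\<Sum>w | barycenter (shore_simplex s) w \<noteq> 0. barycenter (shore_simplex s) w) = 1"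
    if "x s \<noteq> 0" for s w
    using shore_vertex_simplex[OF x(2), of s] barycenter_sum[of "shore_simplex s"] that
    by (simp_all add: barycenter_nonneg barycenter_support)
  show "0 \<le> shore_placement x w"
    "(\<Sum>w | shore_placement x w \<noteq> 0. shore_placement x w) = (\<Sum>s | x s \<noteq> 0. x s)"
    unfolding shore_placement_def using * p by blast+
  have "{w. shore_placement x w \<noteq> 0} = (\<Union>s\<in>{s. x s \<noteq> 0}. {w. barycenter (shore_simplex s) w \<noteq> 0})"
    unfolding shore_placement_def using * p by blast
  then show "{w. shore_placement x w \<noteq> 0} = \<Union>(shore_simplex ` {s. x s \<noteq> 0})"
    using p(2) by auto
qed

lemma shore_placement_box:
  assumes "x \<in> realization (shore_subdivision G)"
  shows "shore_placement x \<in> realization (box_complex G)"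
proof -
  have x: "\<And>s. 0 \<le> x s" "{s. x s \<noteq> 0} \<in> shore_subdivision G" "(\<Sum>s | x s \<noteq> 0. x s) = 1"
    using assms by (auto simp: realization_def)
  have "{s. x s \<noteq> 0} \<noteq> {}" using x(3) by (metis sum.empty zero_neq_one)
  then have "{w. shore_placement x w \<noteq> 0} \<in> box_complex G"
    unfolding shore_placement_support[OF x(1,2)] by (rule Union_shore_simplex_box[OF x(2)])
  then show ?thesis
    using x(3) by (simp add: realization_def shore_placement_nonneg[OF x(1,2)]
        shore_placement_sum[OF x(1,2)])
qed

text \<open>The level weights recover the coefficients of the layer-cake sum on each shore. Vertices
  with \<open>x s = 0\<close> are included, so that later sums can run over one fixed set of
  vertices.\<close>

lemma shore_coords_shore_placement:
  assumes x: "x \<in> realization (shore_subdivision G)" and s: "s \<in> Pow (pverts G) <+> Pow (pverts G)"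
  shows "shore_coords (pverts G) (shore_placement x) s = x s"
proof -
  \<comment> \<open>Stated for arbitrary \<open>x\<close>, because the second shore is obtained by
    applying it to \<open>x \<circ> swap_shores\<close>.\<close>
  have coord_Inl: "shore_coords (pverts G) (shore_placement x) (Inl A) = x (Inl A)"
    if x: "x \<in> realization (shore_subdivision G)" and A: "A \<subseteq> pverts G" for x A
  proof -
    have S: "{s. x s \<noteq> 0} \<in> shore_subdivision G" and nn: "\<And>s. 0 \<le> x s"
      using x by (auto simp: realization_def)
    have fin: "finite {s. x s \<noteq> 0}" using S by (rule finite_shore_subdivision)
    define c where "c = (\<lambda>A. x (Inl A) / card A)"
    define \<C> where "\<C> = {A. x (Inl A) \<noteq> 0}"
    have W: "{s. x s \<noteq> 0} \<subseteq> (neighborhood_complex G - {{}}) <+> (neighborhood_complex G - {{}})"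
      and comp: "\<And>s t. x s \<noteq> 0 \<Longrightarrow> x t \<noteq> 0 \<Longrightarrow> shore_compat G s t"
      using S unfolding shore_subdivision_iff by blast+
    have "\<C> \<subseteq> neighborhood_complex G - {{}}"
    proof
      fix B assume "B \<in> \<C>"
      then have "Inl B \<in> {s. x s \<noteq> 0}" by (simp add: \<C>_def)
      then have "Inl B \<in> (neighborhood_complex G - {{}}) <+> (neighborhood_complex G - {{}})"
        using W by (rule rev_subsetD)
      then show "B \<in> neighborhood_complex G - {{}}" by auto
    qed
    moreover have "B \<subseteq> B' \<or> B' \<subseteq> B" if "B \<in> \<C>" "B' \<in> \<C>" for B B'
      using comp[of "Inl B" "Inl B'"] that by (simp add: \<C>_def)
    ultimately have C: "\<C> \<subseteq> Pow (pverts G)" "{} \<notin> \<C>" "chain\<^sub>\<subseteq> \<C>"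
      by (auto simp: neighborhood_complex_def chain_subset_def)
    have c: "0 < c B" "card B \<noteq> 0" if "B \<in> \<C>" for B
    proof -
      have "finite B" "B \<noteq> {}" using that C by (auto intro: finite_subset[OF _ pair_finite_verts])
      then show "card B \<noteq> 0" "0 < c B"
        using that nn[of "Inl B"] by (auto simp: c_def \<C>_def less_le card_gt_0_iff)
    qed
    have P: "(\<lambda>v. shore_placement x (Inl v)) = (\<lambda>v. \<Sum>B | B \<in> \<C> \<and> v \<in> B. c B)"
      using shore_placement_Inl[OF fin] by (simp add: \<C>_def c_def)
    have sc: "shore_coords (pverts G) (shore_placement x) (Inl A)
        = card A * level_weight (pverts G) (\<lambda>v. \<Sum>B | B \<in> \<C> \<and> v \<in> B. c B) A"
      unfolding P[symmetric] by (simp add: shore_coords_def)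
    show ?thesis
    proof (cases "A \<in> \<C>")
      case True
      then have "level_weight (pverts G) (\<lambda>v. \<Sum>B | B \<in> \<C> \<and> v \<in> B. c B) A = c A"
        using c(1) C pair_finite_verts by (intro level_weight_chain_mem) (auto intro: less_imp_le)
      then show ?thesis using c(2)[OF True] unfolding sc by (simp add: c_def)
    next
      case False
      then have "A \<noteq> {} \<Longrightarrow> level_weight (pverts G) (\<lambda>v. \<Sum>B | B \<in> \<C> \<and> v \<in> B. c B) A = 0"
        using c(1) C A pair_finite_verts by (intro level_weight_chain_nonmem) auto
      moreover have "x (Inl A) = 0" using False by (simp add: \<C>_def)
      ultimately show ?thesis unfolding sc by (cases "A = {}") auto
    qed
  qed
  show ?thesis
  proof (cases s)
    case (Inl A)
    then show ?thesis using coord_Inl[OF x] s by auto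
  next
    case (Inr A)
    have "x \<circ> swap_shores \<in> realization (shore_subdivision G)"
      using shore_subdivision_swap_shores x by (rule realization_swap_shores)
    from coord_Inl[OF this, of A] show ?thesis
      using Inr s by (auto simp: shore_placement_swap_shores shore_coords_swap_shores)
  qed
qed

text \<open>For surjectivity, \<open>y\<close> is decomposed into layers on each shore. The layers
  lie in the two supports of \<open>y\<close>, which are mutually adjacent, so the layers of both
  shores span a simplex.\<close>

lemma shore_placement_image_box:
  "shore_placement ` realization (shore_subdivision G) = realization (box_complex G)"
proof (intro equalityI subsetI)
  fix y assume y: "y \<in> realization (box_complex G)"
  let ?S = "{w. y w \<noteq> 0}"
  have y': "\<And>w. 0 \<le> y w" "?S \<in> box_complex G" "(\<Sum>w | y w \<noteq> 0. y w) = 1"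
    using y by (auto simp: realization_def)
  have box: "{v. y (Inl v) \<noteq> 0} \<in> neighborhood_complex G"
      "{v. y (Inr v) \<noteq> 0} \<in> neighborhood_complex G"
      "{v. y (Inl v) \<noteq> 0} \<subseteq> CN G {v. y (Inr v) \<noteq> 0}"
    using y'(2) unfolding box_complex_iff by (simp_all add: vimage_def)
  have fin: "finite {v. y (Inl v) \<noteq> 0}" "finite {v. y (Inr v) \<noteq> 0}"
    using box pair_finite_verts by (auto simp: neighborhood_complex_def intro: finite_subset)
  obtain c \<A> where A: "\<A> \<subseteq> Pow {v. y (Inl v) \<noteq> 0} - {{}}" "chain\<^sub>\<subseteq> \<A>"
    "\<And>B. B \<in> \<A> \<Longrightarrow> 0 < c B" "\<And>v. y (Inl v) = (\<Sum>B | B \<in> \<A> \<and> v \<in> B. c B)"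
    by (rule layer_decomposition[of "\<lambda>v. y (Inl v)", OF fin(1) y'(1)]) (rule that)
  obtain d \<B> where B: "\<B> \<subseteq> Pow {v. y (Inr v) \<noteq> 0} - {{}}" "chain\<^sub>\<subseteq> \<B>"
    "\<And>B. B \<in> \<B> \<Longrightarrow> 0 < d B" "\<And>v. y (Inr v) = (\<Sum>B | B \<in> \<B> \<and> v \<in> B. d B)"
    by (rule layer_decomposition[of "\<lambda>v. y (Inr v)", OF fin(2) y'(1)]) (rule that)
  \<comment> \<open>The factors \<open>card A\<close> cancel the denominators of the
    barycenters.\<close>
  define x where "x = case_sum (\<lambda>A. if A \<in> \<A> then card A * c A else 0)
    (\<lambda>A. if A \<in> \<B> then card A * d A else 0)"
  have cA: "0 < card D" if "D \<in> \<A>" for D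
    using that A(1) fin(1) by (auto simp: card_gt_0_iff intro: finite_subset)
  have cB: "0 < card D" if "D \<in> \<B>" for D
    using that B(1) fin(2) by (auto simp: card_gt_0_iff intro: finite_subset)
  have xA: "x (Inl D) \<noteq> 0 \<longleftrightarrow> D \<in> \<A>" for D
    using cA[of D] A(3)[of D] by (auto simp: x_def)
  have xB: "x (Inr D) \<noteq> 0 \<longleftrightarrow> D \<in> \<B>" for D
    using cB[of D] B(3)[of D] by (auto simp: x_def)
  have nn: "0 \<le> x s" for s
    using A(3) B(3) by (cases s) (auto simp: x_def intro!: mult_nonneg_nonneg intro: less_imp_le)
  have supp: "{s. x s \<noteq> 0} = \<A> <+> \<B>"
  proof -
    have "x s \<noteq> 0 \<longleftrightarrow> s \<in> \<A> <+> \<B>" for s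
      by (cases s) (simp_all add: xA xB InlI InrI Plus_def image_iff)
    then show ?thesis by blast
  qed
  have ssd: "{s. x s \<noteq> 0} \<in> shore_subdivision G"
  proof -
    have "\<A> \<subseteq> neighborhood_complex G - {{}}" "\<B> \<subseteq> neighborhood_complex G - {{}}"
      using A(1) B(1) box neighborhood_complex_subset by blast+
    moreover have "D \<subseteq> CN G E" if "D \<in> \<A>" "E \<in> \<B>" for D E
    proof -
      have "D \<subseteq> CN G {v. y (Inr v) \<noteq> 0}" using A(1) that box(3) by blast
      also have "\<dots> \<subseteq> CN G E" using B(1) that by (intro CN_antimono) blast
      finally show ?thesis .
    qed
    ultimately show ?thesis using A(2) B(2)
      unfolding shore_subdivision_iff supp by (auto simp: chain_subset_def)
  qed
  have finx: "finite {s. x s \<noteq> 0}" using ssd by (rule finite_shore_subdivision)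
  have "shore_placement x w = y w" for w
  proof (cases w)
    case (Inl v)
    have "shore_placement x (Inl v) = (\<Sum>B | B \<in> \<A> \<and> v \<in> B. c B)"
      unfolding shore_placement_Inl[OF finx] xA mem_Collect_eq
      using cA by (intro sum.cong) (auto simp: x_def)
    then show ?thesis using Inl A(4) by simp
  next
    case (Inr v)
    have "shore_placement x (Inr v) = (\<Sum>B | B \<in> \<B> \<and> v \<in> B. d B)"
      unfolding shore_placement_Inr[OF finx] xB mem_Collect_eq
      using cB by (intro sum.cong) (auto simp: x_def)
    then show ?thesis using Inr B(4) by simp
  qed
  then have Px: "shore_placement x = y" by blast
  \<comment> \<open>Placement preserves total mass, so the normalization of \<open>x\<close> is read
    off from that of \<open>y\<close>.\<close>
  then have "(\<Sum>s | x s \<noteq> 0. x s) = 1"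
    using shore_placement_sum[OF nn ssd] y'(3) by simp
  then have "x \<in> realization (shore_subdivision G)"
    using nn ssd by (simp add: realization_def)
  with Px show "y \<in> shore_placement ` realization (shore_subdivision G)" by blast
qed (use shore_placement_box in auto)

section \<open>Equivariant deformations along straight lines\<close>

text \<open>
  The homotopy may leave the realization of \<open>L\<close>; it only has to stay inside the box complex.
\<close>

definition deforms_onto :: "('a set + 'a set) set set \<Rightarrow> ('a set + 'a set) set set \<Rightarrow> bool" where
  "deforms_onto L M \<longleftrightarrow> (\<exists>\<phi>. homotopic_with_canon
     (\<lambda>h. (\<forall>y\<in>shore_placement ` realization M. h y = y) \<and>
          (\<forall>y\<in>shore_placement ` realization L. h (y \<circ> swap_shores) = h y \<circ> swap_shores))
     (shore_placement ` realization L) (realization (box_complex G)) id \<phi> \<and>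
     \<phi> ` shore_placement ` realization L \<subseteq> shore_placement ` realization M)"

lemma realization_mono: "K \<subseteq> L \<Longrightarrow> realization K \<subseteq> realization L"
  by (auto simp: realization_def)

text \<open>The second homotopy starts only from the points of \<open>L\<close>. Precomposed with
  the retraction \<open>\<rho>\<close> onto \<open>L\<close>, it runs from \<open>\<rho>\<close> to
  \<open>\<phi> \<circ> \<rho>\<close> on the whole box complex and is appended to the first. It
  still fixes \<open>M\<close>, because \<open>\<rho>\<close> fixes \<open>L\<close>, which contains
  \<open>M\<close>.\<close>

lemma deforms_onto_trans:
  assumes "deforms_onto (shore_subdivision G) L" "deforms_onto L M" "M \<subseteq> L"
  shows "deforms_onto (shore_subdivision G) M"
proof -
  let ?X = "realization (box_complex G)"
  let ?P = "\<lambda>K. shore_placement ` realization K"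
  let ?Q = "\<lambda>M L h. (\<forall>y\<in>?P M. h y = y) \<and> (\<forall>y\<in>?P L. h (y \<circ> swap_shores) = h y \<circ> swap_shores)"
  obtain \<rho> where \<rho>: "homotopic_with_canon (?Q L (shore_subdivision G)) ?X ?X id \<rho>" "\<rho> ` ?X \<subseteq> ?P L"
    using assms(1) unfolding deforms_onto_def shore_placement_image_box by blast
  obtain \<phi> where \<phi>: "homotopic_with_canon (?Q M L) (?P L) ?X id \<phi>" "\<phi> ` ?P L \<subseteq> ?P M"
    using assms(2) unfolding deforms_onto_def by blast
  have sub: "?P M \<subseteq> ?P L" using realization_mono[OF assms(3)] by blast
  have Q: "?Q L (shore_subdivision G) \<rho>" using homotopic_with_imp_property[OF \<rho>(1)] by blast
  have "continuous_on ?X \<rho>" using homotopic_with_imp_continuous[OF \<rho>(1)] by blast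
  then have \<rho>c: "continuous_map (top_of_set ?X) (top_of_set (?P L)) \<rho>"
    using \<rho>(2) by auto
  have 2: "homotopic_with_canon (?Q M (shore_subdivision G)) ?X ?X (id \<circ> \<rho>) (\<phi> \<circ> \<rho>)"
    using \<phi>(1) \<rho>c
  proof (rule homotopic_with_compose_continuous_map_right)
    fix j assume j: "?Q M L j"
    show "?Q M (shore_subdivision G) (j \<circ> \<rho>)"
    proof (intro conjI ballI)
      fix y assume "y \<in> ?P M"
      then show "(j \<circ> \<rho>) y = y" using j Q sub by (metis comp_apply subsetD)
    next
      fix y assume y: "y \<in> ?P (shore_subdivision G)"
      then have "\<rho> y \<in> ?P L" using \<rho>(2) unfolding shore_placement_image_box by blast
      then show "(j \<circ> \<rho>) (y \<circ> swap_shores) = (j \<circ> \<rho>) y \<circ> swap_shores"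
        using j Q y by (metis comp_apply)
    qed
  qed
  have 1: "homotopic_with_canon (?Q M (shore_subdivision G)) ?X ?X id \<rho>"
    using \<rho>(1) by (rule homotopic_with_mono) (use sub in blast)
  have "homotopic_with_canon (?Q M (shore_subdivision G)) ?X ?X id (\<phi> \<circ> \<rho>)"
    using 1 2[unfolded id_comp] by (rule homotopic_with_trans)
  moreover have "(\<phi> \<circ> \<rho>) ` ?X \<subseteq> ?P M" using \<rho>(2) \<phi>(2) by (auto simp: image_subset_iff)
  ultimately show ?thesis
    unfolding deforms_onto_def shore_placement_image_box by blast
qed

text \<open>The last hypothesis speaks of box simplices: the union of \<open>\<sigma>\<close> and
  its image need not be a simplex of the subdivision, it only has to be covered by the box simplex
  that some \<open>\<tau>\<close> determines.\<close>

lemma deforms_onto_simplicial_map: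
  assumes L: "L \<subseteq> shore_subdivision G" and sub: "M \<subseteq> L"
    and fM: "\<And>\<sigma>. \<sigma> \<in> L \<Longrightarrow> f ` \<sigma> \<in> M"
    and fixed: "\<And>\<sigma> s. \<sigma> \<in> M \<Longrightarrow> s \<in> \<sigma> \<Longrightarrow> f s = s"
    and swap: "\<And>\<sigma> s. \<sigma> \<in> L \<Longrightarrow> s \<in> \<sigma> \<Longrightarrow> f (swap_shores s) = swap_shores (f s)"
    and carrier: "\<And>\<sigma>. \<sigma> \<in> L \<Longrightarrow> \<exists>\<tau>\<in>shore_subdivision G.
       \<Union>(shore_simplex ` (\<sigma> \<union> f ` \<sigma>)) \<subseteq> \<Union>(shore_simplex ` \<tau>)"
  shows "deforms_onto L M"
proof -
  let ?X = "realization (box_complex G)"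
  let ?P = "\<lambda>K. shore_placement ` realization K"
  let ?U = "Pow (pverts G) <+> Pow (pverts G)"
  let ?g = "shore_coords (pverts G)"
  let ?b = "\<lambda>s. barycenter (shore_simplex s)"
  \<comment> \<open>A sum over all conceivable vertices instead of the support of \<open>y\<close>:
    its continuity is that of the coordinates, and on placed points it agrees with the placement of
    the simplicial map.\<close>
  define \<phi> where "\<phi> y = (\<lambda>w. \<Sum>s\<in>?U. ?g y s * ?b (f s) w)" for y
  have fU: "finite ?U" using pair_finite_verts by simp
  have LS: "x \<in> realization (shore_subdivision G)" if "x \<in> realization L" for x
    using realization_mono[OF L] that by blast
  have swU: "swap_shores ` ?U = ?U" by (rule swap_shores_image)
  have \<phi>P: "\<phi> (shore_placement x) = shore_placement (realization_map f x)"
    and fx: "realization_map f x \<in> realization M" "{s. x s \<noteq> 0} \<in> L"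
    if x: "x \<in> realization L" for x
  proof -
    have x': "\<And>s. 0 \<le> x s" "{s. x s \<noteq> 0} \<in> L" "(\<Sum>s | x s \<noteq> 0. x s) = 1"
      using x by (auto simp: realization_def)
    have fin: "finite {s. x s \<noteq> 0}" and subU: "{s. x s \<noteq> 0} \<subseteq> ?U"
      using x'(2) L finite_shore_subdivision shore_subdivision_subset by blast+
    have "\<phi> (shore_placement x) w = affine_extension (?b \<circ> f) x w" for w
      unfolding \<phi>_def affine_extension_eq_sum[OF fU subU]
      using shore_coords_shore_placement[OF LS[OF x]] by (intro sum.cong) auto
    then show "\<phi> (shore_placement x) = shore_placement (realization_map f x)"
      unfolding shore_placement_def affine_extension_realization_map[OF fin] by blast
    show "{s. x s \<noteq> 0} \<in> L" by fact
    note rm = realization_map_support[OF x'(1) fin x'(3), of f]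
    show "realization_map f x \<in> realization M"
      unfolding realization_def
    proof (intro CollectI conjI allI)
      show "{s. realization_map f x s \<noteq> 0} \<in> M" unfolding rm(2) by (rule fM[OF x'(2)])
    qed (fact rm)+
  qed
  have fixP: "\<phi> y = y" if y: "y \<in> ?P M" for y
  proof -
    obtain x where x: "x \<in> realization M" "y = shore_placement x" using y by blast
    then have xL: "x \<in> realization L" and M: "{s. x s \<noteq> 0} \<in> M"
      using realization_mono[OF sub] by (auto simp: realization_def)
    have "finite {s. x s \<noteq> 0}" using M sub L finite_shore_subdivision by blast
    then have "\<phi> y = affine_extension (?b \<circ> f) x"
      unfolding x(2) \<phi>P[OF xL] unfolding shore_placement_def by (rule affine_extension_realization_map)
    also have "\<dots> = y"
      unfolding x(2) shore_placement_def affine_extension_def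
      using fixed[OF M] by (intro ext sum.cong) auto
    finally show ?thesis .
  qed
  have \<phi>swap: "\<phi> (y \<circ> swap_shores) = \<phi> y \<circ> swap_shores" if y: "y \<in> ?P L" for y
  proof
    fix w
    obtain x where x: "x \<in> realization L" "y = shore_placement x" using y by blast
    have "\<phi> (y \<circ> swap_shores) w = (\<Sum>s\<in>swap_shores ` ?U. ?g y (swap_shores s) * ?b (f s) w)"
      unfolding swU \<phi>_def by (simp add: shore_coords_swap_shores)
    also have "\<dots> = (\<Sum>s\<in>?U. ?g y s * ?b (f (swap_shores s)) w)"
      by (rule sum_swap_shores) simp
    also have "\<dots> = (\<Sum>s\<in>?U. ?g y s * ?b (f s) (swap_shores w))"
    proof (rule sum.cong[OF refl])
      fix s assume s: "s \<in> ?U"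
      show "?g y s * ?b (f (swap_shores s)) w = ?g y s * ?b (f s) (swap_shores w)"
      \<comment> \<open>Equivariance of \<open>f\<close> is given only on vertices of
        \<open>L\<close>; elsewhere the coordinate vanishes and the value of \<open>f\<close> is
        immaterial.\<close>
      proof (cases "x s = 0")
        case True
        then show ?thesis using shore_coords_shore_placement[OF LS[OF x(1)] s] x(2) by simp
      next
        case False
        then have "f (swap_shores s) = swap_shores (f s)" using swap[OF fx(2)[OF x(1)]] by simp
        then show ?thesis by (simp add: barycenter_shore_simplex_swap)
      qed
    qed
    finally show "\<phi> (y \<circ> swap_shores) w = (\<phi> y \<circ> swap_shores) w" by (simp add: \<phi>_def)
  qed
  define h where "h = (\<lambda>(t, y) w. (1 - t) * y w + t * \<phi> y w)"
  have cont: "continuous_on ({0..1} \<times> ?P L) h"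
  proof (rule continuous_on_coordinatewise_then_product)
    fix w
    have g: "continuous_on UNIV (\<lambda>y. ?g y s)" if "s \<in> ?U" for s
      using continuous_on_shore_coords[OF pair_finite_verts that] .
    have s: "continuous_on S (\<lambda>z. ?g (snd z) s)" if "s \<in> ?U"
      for s and S :: "(real \<times> ('a + 'a \<Rightarrow> real)) set"
      using continuous_on_compose2[OF g[OF that] continuous_on_snd[OF continuous_on_id]] by simp
    have y: "continuous_on S (\<lambda>z. snd z w)" for S :: "(real \<times> ('a + 'a \<Rightarrow> real)) set"
      by (rule continuous_on_product_then_coordinatewise) (intro continuous_intros)
    have "continuous_on ({0..1} \<times> ?P L)
        (\<lambda>z. (1 - fst z) * snd z w + fst z * (\<Sum>s\<in>?U. ?g (snd z) s * ?b (f s) w))"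
      by (intro continuous_intros s y)
    then show "continuous_on ({0..1} \<times> ?P L) (\<lambda>z. h z w)"
      by (simp add: h_def \<phi>_def case_prod_beta)
  qed
  have hX: "h (t, y) \<in> ?X" if t: "t \<in> {0..1}" and y: "y \<in> ?P L" for t y
  proof -
    obtain x where x: "x \<in> realization L" "y = shore_placement x" using y by blast
    let ?x' = "realization_map f x" and ?\<sigma> = "{s. x s \<noteq> 0}"
    have x': "?x' \<in> realization (shore_subdivision G)"
      using fx(1)[OF x(1)] sub LS realization_mono by blast
    obtain \<tau> where \<tau>: "\<tau> \<in> shore_subdivision G"
      "\<Union>(shore_simplex ` (?\<sigma> \<union> f ` ?\<sigma>)) \<subseteq> \<Union>(shore_simplex ` \<tau>)"
      using carrier[OF fx(2)[OF x(1)]] by blast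
    have x0: "\<And>s. 0 \<le> x s" "?\<sigma> \<in> shore_subdivision G" "(\<Sum>s | x s \<noteq> 0. x s) = 1"
      using LS[OF x(1)] by (auto simp: realization_def)
    have x'0: "\<And>s. 0 \<le> ?x' s" "{s. ?x' s \<noteq> 0} \<in> shore_subdivision G"
      using x' by (auto simp: realization_def)
    have supp: "{s. ?x' s \<noteq> 0} = f ` ?\<sigma>"
      by (rule realization_map_support[OF x0(1) finite_shore_subdivision[OF x0(2)] x0(3)])
    have "?\<sigma> \<noteq> {}" using x0(3) by (metis sum.empty zero_neq_one)
    then obtain s where "s \<in> ?\<sigma>" by blast
    \<comment> \<open>\<open>\<tau>\<close> covers a nonempty shore simplex;
      \<open>Union_shore_simplex_box\<close> needs it to be nonempty.\<close>
    then have "\<tau> \<noteq> {}" using \<tau>(2) shore_vertex_simplex(2)[OF x0(2)] by fastforce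
    then have box: "\<Union>(shore_simplex ` \<tau>) \<in> box_complex G"
      using \<tau>(1) Union_shore_simplex_box by blast
    show ?thesis
      unfolding h_def prod.case
    proof (rule realization_convex)
      show "y \<in> ?X" using shore_placement_box LS x by blast
      show "\<phi> y \<in> ?X" unfolding x(2) \<phi>P[OF x(1)] using x' by (rule shore_placement_box)
      show "{w. y w \<noteq> 0} \<subseteq> \<Union>(shore_simplex ` \<tau>)"
        unfolding x(2) shore_placement_support[OF x0(1,2)] using \<tau>(2) by blast
      show "{w. \<phi> y w \<noteq> 0} \<subseteq> \<Union>(shore_simplex ` \<tau>)"
        unfolding x(2) \<phi>P[OF x(1)] shore_placement_support[OF x'0] supp using \<tau>(2) by blast
    qed (use t box box_complex_subset finite_box_complex in auto)
  qed
  have "homotopic_with_canon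
     (\<lambda>h. (\<forall>y\<in>?P M. h y = y) \<and> (\<forall>y\<in>?P L. h (y \<circ> swap_shores) = h y \<circ> swap_shores))
     (?P L) ?X id \<phi>"
    unfolding homotopic_with_def
  proof (intro exI[of _ h] conjI ballI allI)
    show "continuous_map (prod_topology (top_of_set {0..1}) (top_of_set (?P L))) (top_of_set ?X) h"
      using cont hX by (auto simp flip: subtopology_Times)
    show "h (0, y) = id y" "h (1, y) = \<phi> y" for y by (simp_all add: h_def)
    show "h (t, y) = y" if "y \<in> ?P M" for t y
      using fixP[OF that] by (simp add: h_def algebra_simps)
    show "h (t, y \<circ> swap_shores) = h (t, y) \<circ> swap_shores" if "y \<in> ?P L" for t y
      using \<phi>swap[OF that] by (auto simp: h_def)
  qed
  moreover have "\<phi> ` ?P L \<subseteq> ?P M" using \<phi>P fx(1) by auto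
  ultimately show ?thesis unfolding deforms_onto_def by blast
qed

end

section \<open>The double common neighborhood\<close>

definition shore_closed :: "'a pair_pre_digraph \<Rightarrow> 'a set + 'a set \<Rightarrow> bool" where
  "shore_closed G = case_sum (\<lambda>A. CN G (CN G A) = A) (\<lambda>A. CN G (CN G A) = A)"

context pair_graph
begin

text \<open>\<open>CN\<^sup>2\<close> fixes closed sets, so its image is the subcomplex spanned by
  the closed vertices.\<close>

lemma doubled_lovasz_complex_iff:
  "\<sigma> \<in> doubled_lovasz_complex G \<longleftrightarrow>
     \<sigma> \<in> shore_subdivision G \<and> (\<forall>s\<in>\<sigma>. shore_closed G s)"
proof
  assume "\<sigma> \<in> doubled_lovasz_complex G"
  then obtain \<A> \<B> where \<sigma>: "\<sigma> = \<A> <+> \<B>" and AB: "\<A> \<in> lovasz_complex G" "\<B> \<in> lovasz_complex G"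
    and adj: "\<forall>A\<in>\<A>. \<forall>B\<in>\<B>. \<forall>a\<in>A. \<forall>b\<in>B. (a, b) \<in> parcs G"
    unfolding doubled_lovasz_complex_explicit by blast
  have bary: "\<A> \<in> barycentric_subdivision (neighborhood_complex G)"
    "\<B> \<in> barycentric_subdivision (neighborhood_complex G)"
    and closed: "\<And>A. A \<in> \<A> \<Longrightarrow> CN G (CN G A) = A" "\<And>A. A \<in> \<B> \<Longrightarrow> CN G (CN G A) = A"
    using AB by (auto simp: lovasz_complex_def induced_subcomplex_def)
  have "A \<subseteq> CN G B" if "A \<in> \<A>" "B \<in> \<B>" for A B
  proof
    fix a assume "a \<in> A"
    moreover have "A \<subseteq> pverts G"
      using bary(1) that by (auto simp: barycentric_subdivision_def neighborhood_complex_def)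
    ultimately show "a \<in> CN G B" using adj that by (auto simp: CN_def intro: arc_sym)
  qed
  then have "\<sigma> \<in> shore_subdivision G" using bary \<sigma> unfolding shore_subdivision_def by blast
  moreover have "\<forall>s\<in>\<sigma>. shore_closed G s" unfolding \<sigma> using closed by (auto simp: shore_closed_def)
  ultimately show "\<sigma> \<in> shore_subdivision G \<and> (\<forall>s\<in>\<sigma>. shore_closed G s)" ..
next
  let ?c = "\<lambda>A. CN G (CN G A)"
  assume \<sigma>: "\<sigma> \<in> shore_subdivision G \<and> (\<forall>s\<in>\<sigma>. shore_closed G s)"
  then have "map_sum ?c ?c s = s" if "s \<in> \<sigma>" for s
    using that by (cases s) (auto simp: shore_closed_def)
  then have "map_sum ?c ?c ` \<sigma> = \<sigma>" by simp
  with \<sigma> show "\<sigma> \<in> doubled_lovasz_complex G"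
    unfolding doubled_lovasz_complex_def simplicial_image_def by blast
qed

text \<open>The image simplex serves as carrier, since \<open>A \<subseteq> CN (CN A)\<close>.
  Adjoining it to \<open>\<sigma>\<close> may fail to give a simplex of the subdivision: for
  \<open>A \<subset> A'\<close> the sets \<open>CN (CN A)\<close> and \<open>A'\<close> can be
  incomparable.\<close>

lemma shore_subdivision_deforms_onto_doubled_lovasz_complex:
  "deforms_onto (shore_subdivision G) (doubled_lovasz_complex G)"
proof (rule deforms_onto_simplicial_map)
  let ?c = "\<lambda>A. CN G (CN G A)"
  let ?f = "map_sum ?c ?c"
  show image: "?f ` \<sigma> \<in> doubled_lovasz_complex G" if "\<sigma> \<in> shore_subdivision G" for \<sigma>
    using that unfolding doubled_lovasz_complex_def simplicial_image_def by blast
  show "?f s = s" if "\<sigma> \<in> doubled_lovasz_complex G" "s \<in> \<sigma>" for \<sigma> s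
    using that unfolding doubled_lovasz_complex_iff by (cases s) (auto simp: shore_closed_def)
  show "?f (swap_shores s) = swap_shores (?f s)" for s
    by (cases s) auto
  show "\<exists>\<tau>\<in>shore_subdivision G. \<Union>(shore_simplex ` (\<sigma> \<union> ?f ` \<sigma>)) \<subseteq> \<Union>(shore_simplex ` \<tau>)"
    if \<sigma>: "\<sigma> \<in> shore_subdivision G" for \<sigma>
  proof (rule bexI)
    show "?f ` \<sigma> \<in> shore_subdivision G"
      using image[OF \<sigma>] by (simp add: doubled_lovasz_complex_iff)
    have "shore_simplex s \<subseteq> shore_simplex (?f s)" if s: "s \<in> \<sigma>" for s
    proof -
      have "s \<in> Pow (pverts G) <+> Pow (pverts G)"
        using shore_subdivision_subset[OF \<sigma>] s by blast
      then show ?thesis using subset_CN2 by (cases s) (auto simp: shore_simplex_def)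
    qed
    then show "\<Union>(shore_simplex ` (\<sigma> \<union> ?f ` \<sigma>)) \<subseteq> \<Union>(shore_simplex ` ?f ` \<sigma>)" by blast
  qed
qed (auto simp: doubled_lovasz_complex_iff)

end

section \<open>Halving one cardinality at a time\<close>

text \<open>A threshold rather than an equation for the size: a composite of stages is then again
  given by one formula, which is the identity for large \<open>n\<close> and the full halving map
  for \<open>n = 0\<close>.\<close>

definition partial_halving ::
    "'a pair_pre_digraph \<Rightarrow> 'a rel \<Rightarrow> nat \<Rightarrow> 'a set + 'a set \<Rightarrow> 'a set + 'a set" where
  "partial_halving G r n s = (if n \<le> case_sum card card s then halving_map G r s else s)"

text \<open>Described by fixed vertices instead of as an image, so that membership adds a condition
  on single vertices to those of a flag complex.\<close>

definition partially_halved_complex ::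
    "'a pair_pre_digraph \<Rightarrow> 'a rel \<Rightarrow> nat \<Rightarrow> ('a set + 'a set) set set" where
  "partially_halved_complex G r n =
     {\<sigma> \<in> doubled_lovasz_complex G. \<forall>s\<in>\<sigma>. partial_halving G r n s = s}"

definition lovasz_vertices :: "'a pair_pre_digraph \<Rightarrow> 'a set set" where
  "lovasz_vertices G = {A. A \<noteq> {} \<and> A \<subseteq> pverts G \<and> CN G A \<noteq> {} \<and> CN G (CN G A) = A}"

context pair_graph
begin

lemma CN_lovasz_vertices: "A \<in> lovasz_vertices G \<Longrightarrow> CN G A \<in> lovasz_vertices G"
  using CN_subset by (auto simp: lovasz_vertices_def)

lemma CN_CN_lovasz_vertices: "A \<in> lovasz_vertices G \<Longrightarrow> CN G (CN G A) = A"
  by (simp add: lovasz_vertices_def)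

lemma lovasz_vertices_subset: "A \<in> lovasz_vertices G \<Longrightarrow> A \<subseteq> pverts G"
  by (simp add: lovasz_vertices_def)

lemma finite_lovasz_vertex: "A \<in> lovasz_vertices G \<Longrightarrow> finite A"
  using lovasz_vertices_subset pair_finite_verts finite_subset by blast

lemma doubled_lovasz_complex_flag:
  "\<sigma> \<in> doubled_lovasz_complex G \<longleftrightarrow>
     \<sigma> \<subseteq> lovasz_vertices G <+> lovasz_vertices G \<and> (\<forall>s\<in>\<sigma>. \<forall>t\<in>\<sigma>. shore_compat G s t)"
proof -
  have "s \<in> lovasz_vertices G <+> lovasz_vertices G \<longleftrightarrow>
      s \<in> (neighborhood_complex G - {{}}) <+> (neighborhood_complex G - {{}}) \<and> shore_closed G s" for s
    by (cases s) (auto simp: lovasz_vertices_def neighborhood_complex_def shore_closed_def)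
  then show ?thesis unfolding doubled_lovasz_complex_iff shore_subdivision_iff by blast
qed

text \<open>Without loops \<open>A\<close> differs from \<open>CN G A\<close>, so the order picks
  exactly one of them.\<close>

lemma set_prec_CN_iff:
  assumes r: "linear_order_on (pverts G) r" and A: "A \<in> lovasz_vertices G"
  shows "set_prec r (CN G A) A \<longleftrightarrow> \<not> set_prec r A (CN G A)"
proof -
  have "A \<noteq> CN G A" using not_subset_CN_self[of A] A by (auto simp: lovasz_vertices_def)
  then show ?thesis
    using set_prec_total[OF r, of A "CN G A"] set_prec_asym[OF r] A CN_lovasz_vertices[OF A]
    by (meson finite_lovasz_vertex lovasz_vertices_subset)
qed

context
  fixes r :: "'a rel"
  assumes r: "linear_order_on (pverts G) r"
begin

abbreviation "LV \<equiv> lovasz_vertices G <+> lovasz_vertices G"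

lemma halving_map_Inl:
  "halving_map G r (Inl A) = (if set_prec r A (CN G A) then Inl A else Inr (CN G A))"
  by (simp add: halving_map_def)

lemma halving_map_swap_shores:
  "s \<in> LV \<Longrightarrow> halving_map G r (swap_shores s) = swap_shores (halving_map G r s)"
  by (cases s) (auto simp: halving_map_def set_prec_CN_iff[OF r])

lemma halving_map_mem: "s \<in> LV \<Longrightarrow> halving_map G r s \<in> LV"
  by (cases s) (auto simp: halving_map_def CN_lovasz_vertices)

lemma halving_map_idem: "s \<in> LV \<Longrightarrow> halving_map G r (halving_map G r s) = halving_map G r s"
proof (cases s)
  case (Inl A)
  moreover assume "s \<in> LV"
  ultimately have "A \<in> lovasz_vertices G" by auto
  from set_prec_CN_iff[OF r this] CN_CN_lovasz_vertices[OF this]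
  show ?thesis by (simp add: Inl halving_map_def)
next
  case (Inr A)
  moreover assume "s \<in> LV"
  ultimately have "A \<in> lovasz_vertices G" by auto
  from set_prec_CN_iff[OF r this] CN_CN_lovasz_vertices[OF this]
  show ?thesis by (simp add: Inr halving_map_def)
qed

lemma swap_shores_mem: "s \<in> LV \<Longrightarrow> swap_shores s \<in> LV"
  by (cases s) auto

lemma partial_halving_swap_shores:
  "s \<in> LV \<Longrightarrow> partial_halving G r n (swap_shores s) = swap_shores (partial_halving G r n s)"
proof -
  have "case_sum card card (swap_shores s) = case_sum card card s" by (cases s) auto
  then show "s \<in> LV \<Longrightarrow> ?thesis" by (simp add: partial_halving_def halving_map_swap_shores)
qed

lemma partial_halving_mem: "s \<in> LV \<Longrightarrow> partial_halving G r n s \<in> LV"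
  using halving_map_mem by (simp add: partial_halving_def)

lemma partial_halving_halving_map:
  "s \<in> LV \<Longrightarrow> partial_halving G r n (halving_map G r s) = halving_map G r s"
  by (simp add: partial_halving_def halving_map_idem)

text \<open>A vertex is either left alone or sent at once to a fixed point of the halving map, where
  every threshold acts trivially. In either order, only the smaller threshold matters.\<close>

lemma partial_halving_absorb:
  assumes "s \<in> LV" "n \<le> m"
  shows "partial_halving G r n (partial_halving G r m s) = partial_halving G r n s"
    and "partial_halving G r m (partial_halving G r n s) = partial_halving G r n s"
proof -
  have k: "partial_halving G r p s = (if p \<le> case_sum card card s then halving_map G r s else s)" for p
    by (simp add: partial_halving_def)
  note * = partial_halving_halving_map[OF assms(1)]
  show "partial_halving G r n (partial_halving G r m s) = partial_halving G r n s"
    by (cases "m \<le> case_sum card card s") (use assms(2) in \<open>simp_all add: k *\<close>)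
  show "partial_halving G r m (partial_halving G r n s) = partial_halving G r n s"
    by (cases "n \<le> case_sum card card s") (use assms(2) in \<open>simp_all add: k *\<close>)
qed

lemma partial_halving_moves:
  assumes A: "A \<in> lovasz_vertices G"
    and "partial_halving G r (Suc n) (Inl A) = Inl A" "partial_halving G r n (Inl A) \<noteq> Inl A"
  shows "card A = n" "set_prec r (CN G A) A" "partial_halving G r n (Inl A) = Inr (CN G A)"
  using assms set_prec_CN_iff[OF r A]
  by (auto simp: partial_halving_def halving_map_Inl split: if_splits)

section \<open>Compatibility of moved and unmoved vertices at one stage\<close>

lemma shore_compat_swap_LV:
  "s \<in> LV \<Longrightarrow> t \<in> LV \<Longrightarrow> shore_compat G (swap_shores s) (swap_shores t) \<longleftrightarrow> shore_compat G s t"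
  by (rule shore_compat_swap_shores) (auto dest: lovasz_vertices_subset)

text \<open>
  A set that is moved at stage \<open>n\<close> is the largest one on its shore: a strictly larger one would
  have been moved at an earlier stage.
\<close>

lemma shore_compat_partial_halving_Inl:
  assumes A: "A \<in> lovasz_vertices G" and t: "t \<in> LV" and c: "shore_compat G (Inl A) t"
    and fixed: "partial_halving G r (Suc n) (Inl A) = Inl A" "partial_halving G r (Suc n) t = t"
  shows "shore_compat G (partial_halving G r n (Inl A)) t"
proof (cases "partial_halving G r n (Inl A) = Inl A")
  case False
  note moved = partial_halving_moves[OF A fixed(1) False]
  show ?thesis
  proof (cases t)
    case (Inl A')
    have A': "A' \<in> lovasz_vertices G" using t Inl by auto
    have "A' \<subseteq> A"
    proof (rule ccontr)
      assume "\<not> A' \<subseteq> A"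
      with c Inl have "A \<subset> A'" by auto
      then have card: "card A < card A'" using A' finite_lovasz_vertex by (blast intro: psubset_card_mono)
      \<comment> \<open>The size of \<open>A'\<close> is at least \<open>Suc n\<close>, so being
        fixed at the previous stage means that \<open>A'\<close> is the smaller member of its pair.
        The inclusion \<open>CN G A' \<subseteq> CN G A\<close> then bounds its size by that of
        \<open>A\<close>.\<close>
      have "set_prec r A' (CN G A')"
        using fixed(2) card moved(1) Inl
        by (auto simp: partial_halving_def halving_map_Inl split: if_splits)
      then have "card A' \<le> card (CN G A')" by (rule set_prec_card_le)
      also have "\<dots> \<le> card (CN G A)"
        using \<open>A \<subset> A'\<close> A CN_lovasz_vertices finite_lovasz_vertex CN_antimono
        by (meson card_mono psubset_imp_subset)
      also have "\<dots> \<le> card A" using moved(2) by (rule set_prec_card_le)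
      finally show False using card by simp
    qed
    then show ?thesis using moved(3) Inl A by (simp add: CN_CN_lovasz_vertices)
  next
    case (Inr B)
    then have "B \<subseteq> CN G A"
      using c A t subset_CN_sym[of A B] by (auto dest: lovasz_vertices_subset)
    then show ?thesis using moved(3) Inr by simp
  qed
qed (use c in simp)

lemma shore_compat_partial_halving_left:
  assumes s: "s \<in> LV" and t: "t \<in> LV" and c: "shore_compat G s t"
    and fixed: "partial_halving G r (Suc n) s = s" "partial_halving G r (Suc n) t = t"
  shows "shore_compat G (partial_halving G r n s) t"
proof (cases s)
  case (Inl A)
  then show ?thesis using shore_compat_partial_halving_Inl[of A t n] assms by auto
next
  case (Inr A)
  have A: "A \<in> lovasz_vertices G" using s Inr by auto
  have sw: "swap_shores s = Inl A" using Inr by simp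
  have "shore_compat G (partial_halving G r n (Inl A)) (swap_shores t)"
  proof (rule shore_compat_partial_halving_Inl)
    show "shore_compat G (Inl A) (swap_shores t)"
      unfolding sw[symmetric] shore_compat_swap_LV[OF s t] by fact
    show "partial_halving G r (Suc n) (Inl A) = Inl A"
      "partial_halving G r (Suc n) (swap_shores t) = swap_shores t"
      unfolding sw[symmetric] using fixed s t by (simp_all add: partial_halving_swap_shores)
  qed (use A swap_shores_mem[OF t] in auto)
  then show ?thesis
    unfolding sw[symmetric] partial_halving_swap_shores[OF s]
      shore_compat_swap_LV[OF partial_halving_mem[OF s] t] .
qed

text \<open>Moved vertices all have size \<open>n\<close>, so nested ones on one shore coincide. On
  opposite shores \<open>A \<subseteq> CN B\<close> and \<open>B \<subseteq> CN A\<close> become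
  equalities by size, and then each of \<open>A\<close> and \<open>B\<close> would have to precede
  the other.\<close>

lemma shore_compat_partial_halving_both_Inl:
  assumes A: "A \<in> lovasz_vertices G" and t: "t \<in> LV" and c: "shore_compat G (Inl A) t"
    and fixed: "partial_halving G r (Suc n) (Inl A) = Inl A" "partial_halving G r (Suc n) t = t"
    and nt: "partial_halving G r n (Inl A) \<noteq> Inl A" "partial_halving G r n t \<noteq> t"
  shows "t = Inl A"
proof (cases t)
  note moved = partial_halving_moves[OF A fixed(1) nt(1)]
  case (Inl A')
  have A': "A' \<in> lovasz_vertices G" using t Inl by auto
  have "card A' = n" using partial_halving_moves(1)[OF A'] fixed(2) nt(2) Inl by simp
  then have "A' = A"
    using c Inl moved(1) A A' finite_lovasz_vertex card_subset_eq by (metis shore_compat.simps(1))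
  then show ?thesis using Inl by simp
next
  note moved = partial_halving_moves[OF A fixed(1) nt(1)]
  case (Inr B)
  have B: "B \<in> lovasz_vertices G" using t Inr by auto
  have sw: "Inl B = swap_shores t" using Inr by simp
  have "partial_halving G r (Suc n) (Inl B) = Inl B" "partial_halving G r n (Inl B) \<noteq> Inl B"
    unfolding sw using fixed(2) nt(2) t
    by (simp_all add: partial_halving_swap_shores) (metis swap_shores_swap_shores)
  note movedB = partial_halving_moves[OF B this]
  have AB: "A \<subseteq> CN G B" using c Inr by simp
  have BA: "B \<subseteq> CN G A"
    using AB subset_CN_sym[OF lovasz_vertices_subset[OF A] lovasz_vertices_subset[OF B]] by simp
  have fin: "finite (CN G A)" "finite (CN G B)"
    using A B CN_lovasz_vertices finite_lovasz_vertex by blast+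
  have "card (CN G A) \<le> card B" "card (CN G B) \<le> card A"
    using set_prec_card_le[OF moved(2)] set_prec_card_le[OF movedB(2)] moved(1) movedB(1) by simp_all
  then have "B = CN G A" "A = CN G B"
    using card_seteq[OF fin(1) BA] card_seteq[OF fin(2) AB] by blast+
  then show ?thesis using moved(2) movedB(2) set_prec_asym[OF r] by metis
qed

text \<open>Two distinct compatible vertices are never moved at the same stage, which reduces the
  claim to moving one of them.\<close>

lemma shore_compat_partial_halving:
  assumes s: "s \<in> LV" and t: "t \<in> LV" and c: "shore_compat G s t"
    and fixed: "partial_halving G r (Suc n) s = s" "partial_halving G r (Suc n) t = t"
  shows "shore_compat G (partial_halving G r n s) (partial_halving G r n t)"
proof (cases "partial_halving G r n s = s \<or> partial_halving G r n t = t")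
  case True
  then show ?thesis
  proof
    assume *: "partial_halving G r n s = s"
    have "shore_compat G (partial_halving G r n t) s"
      using t s _ fixed(2,1) by (rule shore_compat_partial_halving_left) (use c shore_compat_sym in blast)
    then show ?thesis unfolding * using shore_compat_sym by blast
  next
    assume *: "partial_halving G r n t = t"
    show ?thesis unfolding * using s t c fixed by (rule shore_compat_partial_halving_left)
  qed
next
  case False
  have "s = t"
  proof (cases s)
    case (Inl A)
    then show ?thesis using shore_compat_partial_halving_both_Inl[of A t n] assms False by auto
  next
    case (Inr A)
    have A: "A \<in> lovasz_vertices G" using s Inr by auto
    have sw: "swap_shores s = Inl A" using Inr by simp
    have "swap_shores t = Inl A"
    proof (rule shore_compat_partial_halving_both_Inl)
      show "shore_compat G (Inl A) (swap_shores t)"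
        unfolding sw[symmetric] shore_compat_swap_LV[OF s t] by fact
      show "partial_halving G r (Suc n) (Inl A) = Inl A"
        "partial_halving G r (Suc n) (swap_shores t) = swap_shores t"
        unfolding sw[symmetric] using fixed s t by (simp_all add: partial_halving_swap_shores)
      show "partial_halving G r n (Inl A) \<noteq> Inl A"
        "partial_halving G r n (swap_shores t) \<noteq> swap_shores t"
        unfolding sw[symmetric] partial_halving_swap_shores[OF s] partial_halving_swap_shores[OF t]
        using False by (metis swap_shores_swap_shores)+
    qed (use A swap_shores_mem[OF t] in auto)
    then show ?thesis using sw by (metis swap_shores_swap_shores)
  qed
  then show ?thesis by simp
qed

text \<open>At a halving stage, unlike for \<open>CN\<^sup>2\<close>, the simplex and its image do
  span a simplex of the subdivision. It is the carrier of the stage, and its faces contain the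
  image.\<close>

lemma Un_partial_halving_image:
  assumes "\<sigma> \<in> partially_halved_complex G r (Suc n)"
  shows "\<sigma> \<union> partial_halving G r n ` \<sigma> \<in> doubled_lovasz_complex G"
proof -
  have \<sigma>: "\<sigma> \<subseteq> LV" "\<And>s t. s \<in> \<sigma> \<Longrightarrow> t \<in> \<sigma> \<Longrightarrow> shore_compat G s t"
    "\<And>s. s \<in> \<sigma> \<Longrightarrow> partial_halving G r (Suc n) s = s"
    using assms by (auto simp: partially_halved_complex_def doubled_lovasz_complex_flag)
  have 1: "shore_compat G (partial_halving G r n s) t"
    "shore_compat G (partial_halving G r n s) (partial_halving G r n t)" if "s \<in> \<sigma>" "t \<in> \<sigma>" for s t
    using that \<sigma>
    by (meson shore_compat_partial_halving_left shore_compat_partial_halving subsetD)+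
  moreover have "shore_compat G t (partial_halving G r n s)" if "s \<in> \<sigma>" "t \<in> \<sigma>" for s t
    using 1(1)[OF that] shore_compat_sym by blast
  moreover have "partial_halving G r n s \<in> LV" if "s \<in> \<sigma>" for s
    using \<sigma>(1) that partial_halving_mem by blast
  ultimately show ?thesis
    unfolding doubled_lovasz_complex_flag using \<sigma>(1,2) by blast
qed

lemma doubled_lovasz_complex_subset:
  "\<sigma> \<in> doubled_lovasz_complex G \<Longrightarrow> \<tau> \<subseteq> \<sigma> \<Longrightarrow> \<tau> \<in> doubled_lovasz_complex G"
  unfolding doubled_lovasz_complex_flag by blast

lemma partial_halving_image:
  assumes "\<sigma> \<in> partially_halved_complex G r (Suc n)"
  shows "partial_halving G r n ` \<sigma> \<in> partially_halved_complex G r n"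
proof -
  have "\<sigma> \<subseteq> LV"
    using assms by (auto simp: partially_halved_complex_def doubled_lovasz_complex_flag)
  moreover have "partial_halving G r n ` \<sigma> \<in> doubled_lovasz_complex G"
    using Un_partial_halving_image[OF assms] by (rule doubled_lovasz_complex_subset) simp
  ultimately show ?thesis
    using partial_halving_absorb(1)[OF _ order_refl]
    by (auto simp: partially_halved_complex_def)
qed

lemma partially_halved_complex_mono:
  "partially_halved_complex G r n \<subseteq> partially_halved_complex G r (Suc n)"
proof
  fix \<sigma> assume \<sigma>: "\<sigma> \<in> partially_halved_complex G r n"
  then have "\<sigma> \<subseteq> LV"
    by (auto simp: partially_halved_complex_def doubled_lovasz_complex_flag)
  then show "\<sigma> \<in> partially_halved_complex G r (Suc n)"
    using \<sigma> partial_halving_absorb(2)[of _ n "Suc n"]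
    by (fastforce simp: partially_halved_complex_def)
qed

lemma partially_halved_complex_deforms_onto:
  "deforms_onto (partially_halved_complex G r (Suc n)) (partially_halved_complex G r n)"
proof (rule deforms_onto_simplicial_map[where f = "partial_halving G r n"])
  show "partially_halved_complex G r (Suc n) \<subseteq> shore_subdivision G"
    by (auto simp: partially_halved_complex_def doubled_lovasz_complex_iff)
  show "partial_halving G r n s = s" if "\<sigma> \<in> partially_halved_complex G r n" "s \<in> \<sigma>" for \<sigma> s
    using that by (auto simp: partially_halved_complex_def)
  show "partial_halving G r n (swap_shores s) = swap_shores (partial_halving G r n s)"
    if "\<sigma> \<in> partially_halved_complex G r (Suc n)" "s \<in> \<sigma>" for \<sigma> s
    using that partial_halving_swap_shores
    by (auto simp: partially_halved_complex_def doubled_lovasz_complex_flag)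
  show "\<exists>\<tau>\<in>shore_subdivision G.
      \<Union>(shore_simplex ` (\<sigma> \<union> partial_halving G r n ` \<sigma>)) \<subseteq> \<Union>(shore_simplex ` \<tau>)"
    if "\<sigma> \<in> partially_halved_complex G r (Suc n)" for \<sigma>
    using Un_partial_halving_image[OF that] unfolding doubled_lovasz_complex_iff by blast
qed (fact partially_halved_complex_mono partial_halving_image)+

section \<open>Descent of the threshold from above the number of nodes to 0\<close>

lemma partial_halving_ge:
  assumes "s \<in> LV" "card (pverts G) < n"
  shows "partial_halving G r n s = s"
proof -
  have "card A \<le> card (pverts G)" if "A \<in> lovasz_vertices G" for A
    using that pair_finite_verts by (intro card_mono) (auto dest: lovasz_vertices_subset)
  then have "case_sum card card s \<le> card (pverts G)" using assms(1) by (cases s) auto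
  then show ?thesis using assms(2) by (simp add: partial_halving_def)
qed

lemma partially_halved_complex_ge:
  assumes "card (pverts G) < n"
  shows "partially_halved_complex G r n = doubled_lovasz_complex G"
proof -
  have "partial_halving G r n s = s" if "\<sigma> \<in> doubled_lovasz_complex G" "s \<in> \<sigma>" for \<sigma> s
    using that assms unfolding doubled_lovasz_complex_flag by (blast intro: partial_halving_ge)
  then show ?thesis by (auto simp: partially_halved_complex_def)
qed

text \<open>For \<open>n = 0\<close> this says that the halving map takes simplices to simplices. It
  is obtained by composing the single stages, each of which is known to do so on its own
  complex.\<close>

lemma partial_halving_image_doubled:
  assumes "\<sigma> \<in> doubled_lovasz_complex G" "n \<le> Suc (card (pverts G))"
  shows "partial_halving G r n ` \<sigma> \<in> partially_halved_complex G r n"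
  using assms(2)
proof (induction n rule: inc_induct)
  case base
  have "partial_halving G r (Suc (card (pverts G))) s = s" if "s \<in> \<sigma>" for s
    using that assms(1) unfolding doubled_lovasz_complex_flag
    by (intro partial_halving_ge) auto
  then show ?case using assms(1) by (simp add: partially_halved_complex_ge)
next
  case (step n)
  have "partial_halving G r n ` partial_halving G r (Suc n) ` \<sigma> \<in> partially_halved_complex G r n"
    using step.IH by (rule partial_halving_image)
  moreover have "partial_halving G r n (partial_halving G r (Suc n) s) = partial_halving G r n s"
    if "s \<in> \<sigma>" for s
    using that assms(1) unfolding doubled_lovasz_complex_flag
    by (intro partial_halving_absorb) auto
  ultimately show ?case by (simp add: image_image)
qed

text \<open>A simplex with fixed vertices is its own image; conversely the image of the halving map
  consists of fixed vertices.\<close>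

lemma partially_halved_complex_0:
  "partially_halved_complex G r 0 = halved_doubled_lovasz_complex G r"
proof -
  have k: "partial_halving G r 0 = halving_map G r"
    by (simp add: partial_halving_def fun_eq_iff)
  show ?thesis
  proof (intro equalityI subsetI)
    fix \<sigma> assume \<sigma>: "\<sigma> \<in> partially_halved_complex G r 0"
    then have "\<sigma> = halving_map G r ` \<sigma>" by (simp add: partially_halved_complex_def k)
    with \<sigma> show "\<sigma> \<in> halved_doubled_lovasz_complex G r"
      unfolding halved_doubled_lovasz_complex_def simplicial_image_def partially_halved_complex_def
      by blast
  next
    fix \<sigma> assume "\<sigma> \<in> halved_doubled_lovasz_complex G r"
    then show "\<sigma> \<in> partially_halved_complex G r 0"
      using partial_halving_image_doubled[of _ 0]
      by (auto simp: halved_doubled_lovasz_complex_def simplicial_image_def k)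
  qed
qed

lemma shore_subdivision_deforms_onto_partially_halved:
  assumes "n \<le> Suc (card (pverts G))"
  shows "deforms_onto (shore_subdivision G) (partially_halved_complex G r n)"
  using assms
proof (induction n rule: inc_induct)
  \<comment> \<open>\<open>Suc (card (pverts G))\<close> exceeds the size of every vertex set, so
    nothing has been moved yet.\<close>
  case base
  then show ?case
    using shore_subdivision_deforms_onto_doubled_lovasz_complex
    by (simp add: partially_halved_complex_ge)
next
  case (step n)
  show ?case
    using step.IH partially_halved_complex_deforms_onto partially_halved_complex_mono
    by (rule deforms_onto_trans)
qed

text \<open>Read off from the fixed-vertex description, whose conditions are each invariant under
  the swap.\<close>

lemma halving_map_image_swap_shores:
  assumes "\<sigma> \<in> halved_doubled_lovasz_complex G r"
  shows "swap_shores ` \<sigma> \<in> halved_doubled_lovasz_complex G r"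
proof -
  have \<sigma>: "\<sigma> \<subseteq> LV" "\<And>s t. s \<in> \<sigma> \<Longrightarrow> t \<in> \<sigma> \<Longrightarrow> shore_compat G s t"
    "\<And>s. s \<in> \<sigma> \<Longrightarrow> partial_halving G r 0 s = s"
    using assms unfolding partially_halved_complex_0[symmetric]
    by (auto simp: partially_halved_complex_def doubled_lovasz_complex_flag)
  have "swap_shores s \<in> LV" if "s \<in> \<sigma>" for s using \<sigma>(1) that swap_shores_mem by blast
  moreover have "shore_compat G (swap_shores s) (swap_shores t)" if "s \<in> \<sigma>" "t \<in> \<sigma>" for s t
    using \<sigma> that by (subst shore_compat_swap_LV) auto
  moreover have "partial_halving G r 0 (swap_shores s) = swap_shores s" if "s \<in> \<sigma>" for s
    using \<sigma> that by (subst partial_halving_swap_shores) auto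
  ultimately show ?thesis
    unfolding partially_halved_complex_0[symmetric] partially_halved_complex_def
      doubled_lovasz_complex_flag by blast
qed

end

section \<open>Freeness of the action and assembly of the retraction\<close>

lemma Z2_space_box_complex:
  "Z2_space (realization (box_complex G)) (realization_map swap_shores)"
proof -
  let ?X = "realization (box_complex G)"
  have fin: "finite {s. x s \<noteq> 0}" if "x \<in> ?X" for x
    using that finite_box_complex by (auto simp: realization_def)
  have \<nu>: "realization_map swap_shores x = x \<circ> swap_shores" if "x \<in> ?X" for x
    using fin[OF that] by (rule realization_map_swap_shores)
  have mem: "x \<circ> swap_shores \<in> ?X" if "x \<in> ?X" for x
    using box_complex_swap_shores that by (rule realization_swap_shores)
  have inv: "(x \<circ> swap_shores) \<circ> swap_shores = x" for x :: "'a + 'a \<Rightarrow> real"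
    by (simp add: fun_eq_iff)
  have "continuous_on ?X (\<lambda>x. x \<circ> swap_shores)"
    by (rule continuous_on_coordinatewise_then_product)
      (simp, rule continuous_on_subset[OF continuous_on_product_coordinates], simp)
  then have cont: "continuous_on ?X (realization_map swap_shores)"
    using \<nu> by (simp cong: continuous_on_cong)
  \<comment> \<open>A fixed point has the same nonempty support \<open>A\<close> on both shores, and
    then \<open>A \<subseteq> CN G A\<close>, which looplessness forbids.\<close>
  have free: "x \<circ> swap_shores \<noteq> x" if x: "x \<in> ?X" for x
  proof
    assume eq: "x \<circ> swap_shores = x"
    let ?\<sigma> = "{s. x s \<noteq> 0}"
    have \<sigma>: "?\<sigma> \<in> box_complex G" "(\<Sum>s | x s \<noteq> 0. x s) = 1"
      using x by (auto simp: realization_def)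
    have "x (Inl v) = x (Inr v)" for v
      using fun_cong[OF eq, of "Inl v"] by simp
    then have same: "Inl -` ?\<sigma> = Inr -` ?\<sigma>" by auto
    have "?\<sigma> \<noteq> {}" using \<sigma>(2) by (metis sum.empty zero_neq_one)
    then have "Inl -` ?\<sigma> <+> Inr -` ?\<sigma> \<noteq> {}" by (simp only: vimage_Inl_Inr_Plus not_False_eq_True)
    then have "Inl -` ?\<sigma> \<noteq> {}" unfolding same by blast
    with \<sigma>(1) same show False
      unfolding box_complex_iff using not_subset_CN_self by metis
  qed
  show ?thesis
    unfolding Z2_space_def homeomorphism_def
    using cont free mem inv by (force simp: \<nu> image_iff)
qed

end

theorem theorem3:
  fixes G :: "'a pair_pre_digraph" and r :: "'a rel"
  assumes "pair_graph G"
    and "Digraph_Component.connected (with_proj G)"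
    and "linear_order_on (pverts G) r"
  shows "strong_Z2_deformation_retract
           (realization (box_complex G))
           (realization_map swap_shores)
           (shore_placement ` realization (halved_doubled_lovasz_complex G r))"
proof -
  interpret pair_graph G by fact
  note r = \<open>linear_order_on (pverts G) r\<close>
  let ?X = "realization (box_complex G)"
  let ?H = "halved_doubled_lovasz_complex G r"
  let ?Y = "shore_placement ` realization ?H"
  have swap: "realization_map swap_shores y = y \<circ> swap_shores" if "y \<in> ?X" for y
    using that finite_box_complex by (intro realization_map_swap_shores) (auto simp: realization_def)
  have HS: "?H \<subseteq> shore_subdivision G"
    unfolding partially_halved_complex_0[OF r, symmetric]
    by (auto simp: partially_halved_complex_def doubled_lovasz_complex_iff)
  have YX: "?Y \<subseteq> ?X" using realization_mono[OF HS] shore_placement_box by blast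
  have "realization_map swap_shores ` ?Y \<subseteq> ?Y"
  proof (rule image_subsetI)
    fix y assume y: "y \<in> ?Y"
    then obtain x where x: "x \<in> realization ?H" "y = shore_placement x" by blast
    have "x \<circ> swap_shores \<in> realization ?H"
      using halving_map_image_swap_shores[OF r] x(1) by (rule realization_swap_shores)
    moreover have "realization_map swap_shores y = shore_placement (x \<circ> swap_shores)"
      using swap[of y] y YX x(2) by (auto simp: shore_placement_swap_shores)
    ultimately show "realization_map swap_shores y \<in> ?Y" by blast
  qed
  moreover have "deforms_onto (shore_subdivision G) ?H"
    using shore_subdivision_deforms_onto_partially_halved[OF r, of 0]
    by (simp add: partially_halved_complex_0[OF r])
  then obtain \<phi> where hom: "homotopic_with_canon
      (\<lambda>h. (\<forall>y\<in>?Y. h y = y) \<and> (\<forall>y\<in>?X. h (y \<circ> swap_shores) = h y \<circ> swap_shores)) ?X ?X id \<phi>"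
    and \<phi>: "\<phi> ` ?X \<subseteq> ?Y"
    unfolding deforms_onto_def shore_placement_image_box by blast
  let ?Q = "\<lambda>h. (\<forall>y\<in>?Y. h y = y) \<and> (\<forall>y\<in>?X. h (y \<circ> swap_shores) = h y \<circ> swap_shores)"
  obtain h :: "real \<times> ('a + 'a \<Rightarrow> real) \<Rightarrow> 'a + 'a \<Rightarrow> real"
    where h: "continuous_map (prod_topology (top_of_set {0..1}) (top_of_set ?X)) (top_of_set ?X) h"
      "\<forall>y. h (0, y) = id y" "\<forall>y. h (1, y) = \<phi> y" "\<forall>t\<in>{0..1}. ?Q (\<lambda>y. h (t, y))"
    using hom unfolding homotopic_with_def by blast
  have hc: "continuous_on ({0..1} \<times> ?X) h" "h ` ({0..1} \<times> ?X) \<subseteq> ?X"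
    using h(1) by (auto simp: image_subset_iff simp flip: subtopology_Times)
  \<comment> \<open>The library homotopy takes time as its first argument, the retract definition as
    its second.\<close>
  define F where "F = (\<lambda>(y, t). h (t, y))"
  have "continuous_on (?X \<times> {0..1}) (h \<circ> prod.swap)"
    using hc(1) by (intro continuous_on_compose continuous_on_swap) (simp add: product_swap)
  then have "continuous_on (?X \<times> {0..1}) F"
    by (simp add: F_def comp_def prod.swap_def case_prod_beta)
  moreover have FX: "F (y, t) \<in> ?X" if "y \<in> ?X" "t \<in> {0..1}" for y t
    using hc(2) that by (auto simp: F_def)
  moreover have "F (y, 0) = y \<and> F (y, 1) \<in> ?Y" if "y \<in> ?X" for y
    using h(2,3) \<phi> that by (auto simp: F_def)
  moreover have "F (y, t) = y" if "y \<in> ?Y" "t \<in> {0..1}" for y t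
    unfolding F_def prod.case using h(4) that by blast
  moreover have "F (realization_map swap_shores y, t) = realization_map swap_shores (F (y, t))"
    if "y \<in> ?X" "t \<in> {0..1}" for y t
    using h(4) that swap[OF that(1)] swap[OF FX[OF that]] by (simp add: F_def)
  ultimately show ?thesis
    unfolding strong_Z2_deformation_retract_def using Z2_space_box_complex YX
    by (intro conjI exI[of _ F]) auto
qed

end
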